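(* Under the model $LC_n$, the noisy posterior mean curator strategy can answer $q$ queries $\epsilon$-accurately using $n=O\left(\frac1{\epsilon^2}\log\frac q\delta\right)$ samples. That is, there is an absolute constant $C$ such that for all $0<\epsilon,\delta<1$, all integers $q\ge1$ and all integers $n\ge \frac{C}{\epsilon^2}\log\frac q\delta$, if the model is $LC_n$ and the curator receives $n$ samples and uses the noisy posterior mean strategy, then for every adaptive analyst strategy asking $q$ queries, all $q$ answers are $\epsilon$-accurate with probability at least $1-\delta$.
   Context: Bayesian adaptive data analysis. A model consists of a universe $\mathcal X$ and a prior $\mathcal P$ over probability distributions on $\mathcal X$ (hypotheses), both known to the two players, curator and analyst. A distribution $\vec p$ is drawn from $\mathcal P$, unknown to both. The curator receives $n$ independent samples from $\vec p$. The analyst then asks queries $f:\mathcal X\to[0,1]$ one at a time, each possibly depending on previous answers (adaptive strategy); the curator replies to each with $a\in\mathbb R$. The answer is $\epsilon$-accurate if $|\mathbb E_{x\sim\vec p}f(x)-a|<\epsilon$. Probabilities are over $\vec p$, the samples and any randomness of the players. Noisy posterior mean curator: for each query $f$ he answers $\mathbb E_{\vec p\sim\mathcal P'}\mathbb E_{x\sim\vec p}[f(x)]$ plus independent Gaussian noise of mean $0$ and variance $\frac1{4n}$ (fresh for each query), where $\mathcal P'$ is the posterior obtained from $\mathcal P$ by Bayes' rule given the $n$ samples. Linear classification model $LC_m$: universe $\mathbb F_2^m\times\mathbb F_2$; coefficients $a,b_1,\dots,b_m\in\mathbb F_2$ are chosen independently and uniformly, and the hypothesis is the uniform distribution on the graph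 $\{(y,\ell(y)):y\in\mathbb F_2^m\}$ of $\ell(x_1,\dots,x_m)=a+\sum_k b_kx_k$. *)

theory Defs
  imports "HOL-Probability.Probability" "HOL-Library.Z2"
begin

text \<open>
  A model is a universe (a set \<^term>\<open>U\<close>) and a prior over hypotheses. For discrete hypotheses and a
  discrete prior, the latter is a \<^typ>\<open>'x pmf pmf\<close> all of whose hypotheses live on \<^term>\<open>U\<close>.
  The next definition is the joint law of the hypothesis and of \<open>n\<close> independent samples from it.
\<close>

definition hypothesis_and_samples :: "'x pmf pmf \<Rightarrow> nat \<Rightarrow> ('x pmf \<times> 'x list) pmf" where
  "hypothesis_and_samples P n =
     bind_pmf P (\<lambda>p. map_pmf (\<lambda>xs. (p, xs)) (replicate_pmf n p))"

text \<open>
  Meaningful only if \<open>xs\<close> has positive probability, which holds almost surely for the drawn samples.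
\<close>

definition posterior :: "'x pmf pmf \<Rightarrow> 'x list \<Rightarrow> 'x pmf pmf" where
  "posterior P xs =
     map_pmf fst (cond_pmf (hypothesis_and_samples P (length xs)) {(p, ys). ys = xs})"

definition posterior_mean :: "'x pmf pmf \<Rightarrow> 'x list \<Rightarrow> ('x \<Rightarrow> real) \<Rightarrow> real" where
  "posterior_mean P xs f =
     measure_pmf.expectation (posterior P xs) (\<lambda>p. measure_pmf.expectation p f)"

text \<open>The second argument of \<^const>\<open>normal_density\<close> is the standard deviation, not the variance.\<close>

definition noise :: "nat \<Rightarrow> real measure" where
  "noise n = density lborel (normal_density 0 (sqrt (1 / (4 * real n))))"

text \<open>
  The analyst has a private random seed with an arbitrary law \<open>R\<close> on the reals (every randomised
  strategy has this form, up to the joint law of the game; the type of seeds is fixed so that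
  constants cannot depend on it). Her strategy \<open>s r h\<close> is the next query, as a function of the seed
  \<open>r\<close> and the list \<open>h\<close> of all previous answers, oldest first. Earlier queries are determined by
  these data.
\<close>

type_synonym 'x strategy = "real \<Rightarrow> real list \<Rightarrow> 'x \<Rightarrow> real"

definition analyst :: "'x set \<Rightarrow> nat \<Rightarrow> real measure \<Rightarrow> 'x strategy \<Rightarrow> bool" where
  "analyst U q R s \<longleftrightarrow>
     prob_space R \<and> sets R = sets borel \<and>
     (\<forall>r h. \<forall>x\<in>U. length h < q \<longrightarrow> 0 \<le> s r h x \<and> s r h x \<le> 1) \<and>
     (\<forall>i<q. \<forall>x\<in>U. (\<lambda>(r, a). s r (map a [0..<i]) x)
        \<in> borel_measurable (R \<Otimes>\<^sub>M PiM {..<i} (\<lambda>_. borel)))"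

text \<open>
  The first \<open>i\<close> answers of the noisy posterior mean curator with samples \<open>xs\<close> and noise values
  \<open>z 0, z 1, \<dots>\<close>, against the (already seeded) analyst \<open>t\<close>.
\<close>

primrec answers ::
  "'x pmf pmf \<Rightarrow> 'x list \<Rightarrow> (nat \<Rightarrow> real) \<Rightarrow> (real list \<Rightarrow> 'x \<Rightarrow> real) \<Rightarrow> nat \<Rightarrow> real list" where
  "answers P xs z t 0 = []"
| "answers P xs z t (Suc i) =
     (let h = answers P xs z t i in h @ [posterior_mean P xs (t h) + z i])"

definition accurate :: "real \<Rightarrow> 'x pmf \<Rightarrow> ('x \<Rightarrow> real) \<Rightarrow> real \<Rightarrow> bool" where
  "accurate \<epsilon> p f a \<longleftrightarrow> \<bar>measure_pmf.expectation p f - a\<bar> < \<epsilon>"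

definition all_accurate ::
  "'x pmf pmf \<Rightarrow> real \<Rightarrow> nat \<Rightarrow> 'x pmf \<Rightarrow> 'x list \<Rightarrow> (nat \<Rightarrow> real) \<Rightarrow> (real list \<Rightarrow> 'x \<Rightarrow> real) \<Rightarrow> bool"
  where
  "all_accurate P \<epsilon> q p xs z t \<longleftrightarrow>
     (\<forall>i<q. accurate \<epsilon> p (t (answers P xs z t i)) (answers P xs z t (Suc i) ! i))"

text \<open>
  The space of all random choices: hypothesis and samples, noise, seed. Restricting the first factor
  to its support removes only a null set. It is needed because off the support (hypotheses that are
  not in the model, impossible samples) the game is not controlled and the event of interest need not
  be measurable.
\<close>

definition game_space ::
  "'x pmf pmf \<Rightarrow> nat \<Rightarrow> nat \<Rightarrow> real measure
     \<Rightarrow> (('x pmf \<times> 'x list) \<times> (nat \<Rightarrow> real) \<times> real) measure" where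
  "game_space P n q R =
     restrict_space (measure_pmf (hypothesis_and_samples P n)) (set_pmf (hypothesis_and_samples P n))
       \<Otimes>\<^sub>M (PiM {..<q} (\<lambda>_. noise n) \<Otimes>\<^sub>M R)"

definition prob_all_accurate ::
  "'x pmf pmf \<Rightarrow> nat \<Rightarrow> real \<Rightarrow> nat \<Rightarrow> real measure \<Rightarrow> 'x strategy \<Rightarrow> real" where
  "prob_all_accurate P n \<epsilon> q R s =
     \<P>(((p, xs), z, r) in game_space P n q R. all_accurate P \<epsilon> q p xs z (s r))"

text \<open>
  Vectors of \<open>F\<^sub>2\<^sup>m\<close> are functions \<^typ>\<open>nat \<Rightarrow> bit\<close> that vanish outside the index set \<open>{..<m}\<close>;
  \<^typ>\<open>bit\<close> is the two-element field.
\<close>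

definition F2_vectors :: "nat \<Rightarrow> (nat \<Rightarrow> bit) set" where
  "F2_vectors m = {y. \<forall>k\<ge>m. y k = 0}"

definition LC_universe :: "nat \<Rightarrow> ((nat \<Rightarrow> bit) \<times> bit) set" where
  "LC_universe m = F2_vectors m \<times> UNIV"

definition affine_form :: "nat \<Rightarrow> bit \<Rightarrow> (nat \<Rightarrow> bit) \<Rightarrow> (nat \<Rightarrow> bit) \<Rightarrow> bit" where
  "affine_form m a b y = a + (\<Sum>k<m. b k * y k)"

definition LC_hypothesis :: "nat \<Rightarrow> bit \<Rightarrow> (nat \<Rightarrow> bit) \<Rightarrow> ((nat \<Rightarrow> bit) \<times> bit) pmf" where
  "LC_hypothesis m a b = pmf_of_set ((\<lambda>y. (y, affine_form m a b y)) ` F2_vectors m)"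

definition LC_prior :: "nat \<Rightarrow> ((nat \<Rightarrow> bit) \<times> bit) pmf pmf" where
  "LC_prior m =
     map_pmf (\<lambda>(a, b). LC_hypothesis m a b)
       (pair_pmf (pmf_of_set UNIV) (Pi_pmf {..<m} 0 (\<lambda>_. pmf_of_set UNIV)))"

text \<open>
  The remaining facts confirm that the definitions mean what they should: \<^const>\<open>pmf_of_set\<close> is
  applied to finite nonempty sets only, hypotheses live on the universe, \<^const>\<open>posterior\<close>
  satisfies Bayes' formula, and \<^const>\<open>game_space\<close> is a probability space.
\<close>

lemma UNIV_bit: "(UNIV :: bit set) = {0, 1}"
  using bit_not_zero_iff by auto

lemma F2_vectors_eq_PiE_dflt: "F2_vectors m = PiE_dflt {..<m} 0 (\<lambda>_. UNIV)"
  by (auto simp: F2_vectors_def PiE_dflt_def not_less)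

lemma finite_F2_vectors: "finite (F2_vectors m)"
  unfolding F2_vectors_eq_PiE_dflt by (rule finite_PiE_dflt) (simp_all add: UNIV_bit)

lemma card_F2_vectors: "card (F2_vectors m) = 2 ^ m"
  unfolding F2_vectors_eq_PiE_dflt by (subst card_PiE_dflt) (simp_all add: UNIV_bit numeral_2_eq_2)

lemma F2_vectors_nonempty: "F2_vectors m \<noteq> {}"
  by (auto simp: F2_vectors_def intro: exI[of _ "\<lambda>_. 0"])

lemma set_pmf_LC_hypothesis: "set_pmf (LC_hypothesis m a b) \<subseteq> LC_universe m"
  using finite_F2_vectors F2_vectors_nonempty
  by (auto simp: LC_hypothesis_def LC_universe_def)

lemma pmf_hypothesis_and_samples:
  "pmf (hypothesis_and_samples P n) (p, xs) = pmf P p * pmf (replicate_pmf n p) xs"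
proof -
  have *: "pmf (map_pmf (\<lambda>xs. (p', xs)) (replicate_pmf n p')) (p, xs) =
          indicator {p} p' * pmf (replicate_pmf n p) xs" for p'
  proof (cases "p' = p")
    case True
    then show ?thesis by (simp add: pmf_map_inj' inj_on_def)
  next
    case False
    from False have "(p, xs) \<notin> set_pmf (map_pmf (\<lambda>xs. (p', xs)) (replicate_pmf n p'))" by auto
    then have "pmf (map_pmf (\<lambda>xs. (p', xs)) (replicate_pmf n p')) (p, xs) = 0"
      by (simp only: set_pmf_iff not_not)
    with False show ?thesis by simp
  qed
  show ?thesis
    unfolding hypothesis_and_samples_def pmf_bind * by (simp add: measure_pmf_single)
qed

lemma posterior_Bayes:
  assumes "p0 \<in> set_pmf P" "xs \<in> set_pmf (replicate_pmf (length xs) p0)"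
  shows "pmf (posterior P xs) p =
           pmf P p * pmf (replicate_pmf (length xs) p) xs
           / measure_pmf.expectation P (\<lambda>p'. pmf (replicate_pmf (length xs) p') xs)"
proof -
  let ?J = "hypothesis_and_samples P (length xs)"
  let ?S = "{(p, ys). ys = xs} :: ('a pmf \<times> 'a list) set"
  have "(p0, xs) \<in> set_pmf ?J"
    using assms by (auto simp: hypothesis_and_samples_def)
  then have ne: "set_pmf ?J \<inter> ?S \<noteq> {}" by auto
  have sub: "set_pmf (cond_pmf ?J ?S) \<subseteq> ?S"
    using ne by (auto simp: set_cond_pmf)
  have "pmf (posterior P xs) p = measure (cond_pmf ?J ?S) (fst -` {p})"
    by (simp add: posterior_def pmf_map)
  also have "\<dots> = measure (cond_pmf ?J ?S) {(p, xs)}"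
    using sub by (intro measure_pmf.finite_measure_eq_AE) (auto simp: AE_measure_pmf_iff)
  also have "\<dots> = pmf ?J (p, xs) / measure ?J ?S"
    using ne by (simp add: measure_pmf_single pmf_cond)
  also have "measure ?J ?S = pmf (map_pmf snd ?J) xs"
    unfolding pmf_map by (rule arg_cong[where f = "measure ?J"]) auto
  also have "map_pmf snd ?J = bind_pmf P (replicate_pmf (length xs))"
    by (simp add: hypothesis_and_samples_def map_bind_pmf pmf.map_comp comp_def)
  finally show ?thesis
    by (simp add: pmf_hypothesis_and_samples pmf_bind)
qed

lemma prob_space_noise: "n > 0 \<Longrightarrow> prob_space (noise n)"
  unfolding noise_def by (intro prob_space_normal_density) simp

lemma prob_space_game_space:
  assumes "n > 0" "prob_space R"
  shows "prob_space (game_space P n q R)"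
proof -
  let ?J = "hypothesis_and_samples P n"
  have "prob_space (restrict_space (measure_pmf ?J) (set_pmf ?J))"
    by (rule prob_space_restrict_space) (auto simp: measure_pmf.emeasure_eq_measure measure_pmf.prob_eq_1 AE_measure_pmf)
  moreover have "prob_space (PiM {..<q} (\<lambda>_. noise n) \<Otimes>\<^sub>M R)"
    using assms by (intro prob_space_pair prob_space_PiM prob_space_noise)
  ultimately show ?thesis
    unfolding game_space_def by (rule prob_space_pair)
qed

end

theory Submission
  imports Defs
begin

text \<open>
  Let \<open>M f\<close> be the average of a query \<open>f\<close> over the whole universe. By orthogonality of the signs
  \<open>(-1) ^ \<ell>(y)\<close> over a random affine form \<open>\<ell>\<close>, the true answer to a fixed query differs from \<open>M f\<close> by
  at most \<open>2 ^ (- n / 2)\<close> in mean square. By Jensen's inequality so does the posterior mean, as a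
  hypothesis redrawn from the posterior has again the law of the prior. Hence, if the curator answered
  with \<open>M f\<close> plus noise, the queries would be independent of hypothesis and samples, and all of them
  would be exponentially typical. Moving the center of a Gaussian of variance \<open>1 / (4 n)\<close> by the
  exponentially small distance between \<open>M f\<close> and the posterior mean changes its density by a factor
  close to 1, so the same holds for the actual curator. As \<open>q\<close> is at most exponential in \<open>n \<epsilon>\<^sup>2\<close>, the
  Gaussian tail is the only remaining source of error.
\<close>

section \<open>Second moments in the linear classification model\<close>

definition bit_sign :: "bit \<Rightarrow> real" where
  "bit_sign c = (if c = 0 then 1 else -1)"

lemma bit_sign_add: "bit_sign (c + d) = bit_sign c * bit_sign d"
  by (cases c; cases d) (simp_all add: bit_sign_def)

lemma bit_sign_mult_self [simp]: "bit_sign c * bit_sign c = 1"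
  by (simp add: bit_sign_def)

lemma affine_form_flip:
  assumes "k < m"
  shows "affine_form m a (b(k := b k + 1)) y = affine_form m a b y + y k"
proof -
  have "(\<Sum>j<m. (b(k := b k + 1)) j * y j) = (\<Sum>j<m. b j * y j + (if j = k then y k else 0))"
    by (rule sum.cong) (auto simp: distrib_right)
  also have "\<dots> = (\<Sum>j<m. b j * y j) + y k"
    using assms by (simp only: sum.distrib sum.delta finite_lessThan lessThan_iff if_True)
  finally show ?thesis
    by (simp only: affine_form_def add.assoc)
qed

text \<open>Pick a coordinate \<open>k\<close> where \<open>y\<close> and \<open>y'\<close> differ.
  Flipping \<open>b k\<close> is an involution of the coefficient vectors that reverses the sign of
  each summand, so the sum equals its own negative.\<close>

lemma affine_form_signs_orthogonal:
  assumes y: "y \<in> F2_vectors m" "y' \<in> F2_vectors m" "y \<noteq> y'"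
  shows "(\<Sum>b\<in>F2_vectors m. bit_sign (affine_form m a b y) * bit_sign (affine_form m a b y')) = 0"
    (is "sum ?h _ = 0")
proof -
  obtain k where k: "y k \<noteq> y' k" using y(3) by auto
  with y(1,2) have km: "k < m" by (force simp: F2_vectors_def not_less[symmetric])
  have neg: "bit_sign (y k) * bit_sign (y' k) = -1"
    using k by (cases "y k"; cases "y' k") (simp_all add: bit_sign_def)
  define i where "i b = b(k := b k + 1)" for b :: "nat \<Rightarrow> bit"
  have inv: "i (i b) = b" for b by (rule ext) (simp add: i_def)
  have mem: "i b \<in> F2_vectors m" if "b \<in> F2_vectors m" for b
    using that km by (auto simp: F2_vectors_def i_def)
  have flip: "?h (i b) = - ?h b" for b
  proof -
    have "?h (i b) = ?h b * (bit_sign (y k) * bit_sign (y' k))"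
      by (simp only: i_def affine_form_flip[OF km] bit_sign_add mult_ac)
    then show ?thesis by (simp only: neg mult_minus_right mult_1_right)
  qed
  have "sum ?h (F2_vectors m) = sum (\<lambda>b. ?h (i b)) (F2_vectors m)"
    by (rule sum.reindex_bij_witness[of _ i i]) (simp_all add: inv mem)
  also have "\<dots> = - sum ?h (F2_vectors m)"
    by (simp only: flip sum_negf)
  finally show ?thesis by simp
qed

text \<open>Parseval's identity: once the square is expanded, orthogonality leaves only the diagonal
  terms, and each of them occurs once for every \<open>b\<close>.\<close>

lemma sum_affine_form_signs_squared:
  "(\<Sum>b\<in>F2_vectors m. (\<Sum>y\<in>F2_vectors m. bit_sign (affine_form m a b y) * g y)\<^sup>2)
     = 2 ^ m * (\<Sum>y\<in>F2_vectors m. (g y)\<^sup>2)"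
proof -
  let ?F = "F2_vectors m" and ?s = "\<lambda>b y. bit_sign (affine_form m a b y)"
  have "(\<Sum>b\<in>?F. (\<Sum>y\<in>?F. ?s b y * g y)\<^sup>2)
      = (\<Sum>b\<in>?F. \<Sum>y\<in>?F. \<Sum>y'\<in>?F. g y * g y' * (?s b y * ?s b y'))"
    by (simp add: power2_eq_square sum_product mult_ac)
  also have "\<dots> = (\<Sum>y\<in>?F. \<Sum>b\<in>?F. \<Sum>y'\<in>?F. g y * g y' * (?s b y * ?s b y'))"
    by (rule sum.swap)
  also have "\<dots> = (\<Sum>y\<in>?F. \<Sum>y'\<in>?F. \<Sum>b\<in>?F. g y * g y' * (?s b y * ?s b y'))"
    by (intro sum.cong refl sum.swap)
  also have "\<dots> = (\<Sum>y\<in>?F. \<Sum>y'\<in>?F. g y * g y' * (\<Sum>b\<in>?F. ?s b y * ?s b y'))"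
    by (simp only: sum_distrib_left)
  also have "\<dots> = (\<Sum>y\<in>?F. \<Sum>y'\<in>?F. if y' = y then g y * g y * 2 ^ m else 0)"
    by (intro sum.cong refl) (auto simp: affine_form_signs_orthogonal card_F2_vectors)
  also have "\<dots> = (\<Sum>y\<in>?F. g y * g y * 2 ^ m)"
    by (intro sum.cong refl) (simp add: finite_F2_vectors)
  finally show ?thesis
    by (simp add: sum_distrib_left power2_eq_square mult_ac)
qed

lemma expectation_LC_hypothesis:
  "measure_pmf.expectation (LC_hypothesis m a b) f
     = (\<Sum>y\<in>F2_vectors m. f (y, affine_form m a b y) :: real) / 2 ^ m"
proof -
  have inj: "inj_on (\<lambda>y. (y, affine_form m a b y)) (F2_vectors m)" by (auto simp: inj_on_def)
  show ?thesis
    unfolding LC_hypothesis_def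
    by (simp add: integral_pmf_of_set finite_F2_vectors F2_vectors_nonempty card_image[OF inj]
        sum.reindex[OF inj] card_F2_vectors)
qed

text \<open>The answer of a curator who knows nothing about the labels.\<close>

definition LC_center :: "nat \<Rightarrow> ((nat \<Rightarrow> bit) \<times> bit \<Rightarrow> real) \<Rightarrow> real" where
  "LC_center m f = (\<Sum>y\<in>F2_vectors m. (f (y, 0) + f (y, 1)) / 2) / 2 ^ m"

text \<open>The value of \<open>f\<close> at a label is the average over both labels plus or minus
  half their difference. The deviation is thus a signed sum to which Parseval applies.\<close>

lemma expectation_LC_hypothesis_minus_center:
  "measure_pmf.expectation (LC_hypothesis m a b) f - LC_center m f
     = (\<Sum>y\<in>F2_vectors m. bit_sign (affine_form m a b y) * ((f (y, 0) - f (y, 1)) / 2)) / 2 ^ m"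
proof -
  have *: "f (y, c) - (f (y, 0) + f (y, 1)) / 2 = bit_sign c * ((f (y, 0) - f (y, 1)) / 2)" for y c
    by (cases c) (simp_all add: bit_sign_def field_simps)
  show ?thesis
    unfolding expectation_LC_hypothesis LC_center_def diff_divide_distrib[symmetric]
      sum_subtractf[symmetric] * ..
qed

lemma LC_prior_eq:
  "LC_prior m = map_pmf (\<lambda>(a, b). LC_hypothesis m a b) (pmf_of_set (UNIV \<times> F2_vectors m))"
proof -
  have "Pi_pmf {..<m} 0 (\<lambda>_. pmf_of_set (UNIV :: bit set)) = pmf_of_set (F2_vectors m)"
    unfolding F2_vectors_eq_PiE_dflt by (subst Pi_pmf_of_set) (auto simp: UNIV_bit)
  moreover have "pair_pmf (pmf_of_set (UNIV :: bit set)) (pmf_of_set (F2_vectors m))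
      = pmf_of_set (UNIV \<times> F2_vectors m)"
    by (rule pmf_eqI)
      (auto simp: pmf_pair pmf_of_set finite_F2_vectors F2_vectors_nonempty UNIV_bit
        card_cartesian_product indicator_def)
  ultimately show ?thesis by (simp add: LC_prior_def)
qed

lemma finite_set_pmf_LC_prior: "finite (set_pmf (LC_prior m))"
  by (simp add: LC_prior_eq finite_F2_vectors F2_vectors_nonempty UNIV_bit)

lemma set_pmf_LC_priorD: "p \<in> set_pmf (LC_prior m) \<Longrightarrow> set_pmf p \<subseteq> LC_universe m"
  using set_pmf_LC_hypothesis by (force simp: LC_prior_def)

lemma finite_LC_universe: "finite (LC_universe m)"
  by (simp add: LC_universe_def finite_F2_vectors UNIV_bit)

text \<open>The half differences are at most 1/2 in absolute value, so by Parseval the squared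
  deviations sum to at most 1/4 over all \<open>2 ^ m\<close> vectors \<open>b\<close>, for each
  fixed \<open>a\<close>.\<close>

lemma LC_prior_second_moment:
  assumes f: "\<And>x. x \<in> LC_universe m \<Longrightarrow> 0 \<le> f x \<and> f x \<le> 1"
  shows "measure_pmf.expectation (LC_prior m) (\<lambda>p. (measure_pmf.expectation p f - LC_center m f)\<^sup>2)
           \<le> 1 / (4 * 2 ^ m)"
proof -
  let ?F = "F2_vectors m" and ?g = "\<lambda>y. (f (y, 0) - f (y, 1)) / 2"
  let ?d = "\<lambda>a b. measure_pmf.expectation (LC_hypothesis m a b) f - LC_center m f"
  have g: "(?g y)\<^sup>2 \<le> 1 / 4" if "y \<in> ?F" for y
  proof -
    have "\<bar>?g y\<bar> \<le> 1 / 2"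
      using f[of "(y, 0)"] f[of "(y, 1)"] that by (auto simp: LC_universe_def abs_le_iff)
    then have "\<bar>?g y\<bar>\<^sup>2 \<le> (1 / 2)\<^sup>2" by (intro power_mono) auto
    then show ?thesis by (simp add: power2_eq_square)
  qed
  have b: "(\<Sum>b\<in>?F. (?d a b)\<^sup>2) \<le> 1 / 4" for a
  proof -
    have "(\<Sum>b\<in>?F. (?d a b)\<^sup>2) = 2 ^ m * (\<Sum>y\<in>?F. (?g y)\<^sup>2) / (2 ^ m)\<^sup>2"
      by (simp only: expectation_LC_hypothesis_minus_center power_divide
          sum_divide_distrib[symmetric] sum_affine_form_signs_squared)
    also have "\<dots> \<le> 2 ^ m * (\<Sum>y\<in>?F. 1 / 4) / (2 ^ m)\<^sup>2"
      by (intro divide_right_mono mult_left_mono sum_mono g) auto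
    finally show ?thesis by (simp add: card_F2_vectors power2_eq_square)
  qed
  have "measure_pmf.expectation (LC_prior m) (\<lambda>p. (measure_pmf.expectation p f - LC_center m f)\<^sup>2)
      = (\<Sum>(a, b)\<in>UNIV \<times> ?F. (?d a b)\<^sup>2) / (2 * 2 ^ m)"
    by (simp add: LC_prior_eq integral_pmf_of_set finite_F2_vectors F2_vectors_nonempty UNIV_bit
        card_cartesian_product card_F2_vectors case_prod_unfold)
  also have "\<dots> = (\<Sum>a\<in>UNIV. \<Sum>b\<in>?F. (?d a b)\<^sup>2) / (2 * 2 ^ m)"
    by (simp add: sum.cartesian_product)
  also have "\<dots> \<le> (\<Sum>a\<in>(UNIV :: bit set). 1 / 4) / (2 * 2 ^ m)"
    by (intro divide_right_mono sum_mono b) auto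
  also have "\<dots> = 1 / (4 * 2 ^ m)" by (simp add: UNIV_bit)
  finally show ?thesis .
qed

section \<open>Second moment of the posterior mean\<close>

lemma finite_set_pmf_hypothesis_and_samples:
  assumes "finite (set_pmf P)" "\<And>p. p \<in> set_pmf P \<Longrightarrow> finite (set_pmf p)"
  shows "finite (set_pmf (hypothesis_and_samples P n))"
  using assms finite_lists_length_eq
  by (auto simp: hypothesis_and_samples_def set_replicate_pmf lists_eq_set Collect_conj_eq[symmetric] Int_def)

lemma hypothesis_and_samplesD:
  assumes "(p, xs) \<in> set_pmf (hypothesis_and_samples P n)"
  shows "p \<in> set_pmf P" "length xs = n"
  using assms by (auto simp: hypothesis_and_samples_def set_replicate_pmf)

lemma map_fst_hypothesis_and_samples: "map_pmf fst (hypothesis_and_samples P n) = P"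
  by (simp add: hypothesis_and_samples_def map_bind_pmf pmf.map_comp comp_def map_pmf_const
      bind_return_pmf')

text \<open>Tower rule: redrawing the pair from its joint law conditioned on the observed samples
  preserves the joint law, whose first marginal is the prior.\<close>

lemma bind_posterior: "bind_pmf (hypothesis_and_samples P n) (\<lambda>\<omega>. posterior P (snd \<omega>)) = P"
proof -
  let ?J = "hypothesis_and_samples P n"
  \<comment> \<open>Drawn sample lists have length exactly \<open>n\<close>, so the length inside
    \<open>posterior\<close> may be replaced by \<open>n\<close>.\<close>
  have "bind_pmf ?J (\<lambda>\<omega>. posterior P (snd \<omega>))
      = bind_pmf ?J (\<lambda>\<omega>. map_pmf fst (cond_pmf ?J {\<omega>'. snd \<omega>' = snd \<omega>}))"
    by (intro bind_pmf_cong refl)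
      (auto simp: posterior_def case_prod_unfold dest: hypothesis_and_samplesD)
  also have "\<dots> = map_pmf fst (bind_pmf ?J (\<lambda>\<omega>. cond_pmf ?J {\<omega>'. snd \<omega>' = snd \<omega>}))"
    by (simp add: map_bind_pmf)
  also have "bind_pmf ?J (\<lambda>\<omega>. cond_pmf ?J {\<omega>'. snd \<omega>' = snd \<omega>}) = ?J"
    by (rule bind_cond_pmf_cancel) (auto intro: arg_cong[where f = "measure ?J"])
  finally show ?thesis by (simp add: map_fst_hypothesis_and_samples)
qed

lemma set_pmf_posterior_subset:
  assumes "(p, xs) \<in> set_pmf (hypothesis_and_samples P n)"
  shows "set_pmf (posterior P xs) \<subseteq> set_pmf P"
proof -
  have "set_pmf (hypothesis_and_samples P (length xs)) \<inter> {(p, ys). ys = xs} \<noteq> {}"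
    using assms hypothesis_and_samplesD[OF assms] by auto
  then show ?thesis
    by (auto simp: posterior_def set_cond_pmf dest: hypothesis_and_samplesD)
qed

text \<open>Jensen's inequality for the square, read off from the nonnegativity of the
  variance.\<close>

lemma square_expectation_le:
  assumes "finite (set_pmf p)"
  shows "(measure_pmf.expectation p X)\<^sup>2 \<le> measure_pmf.expectation p (\<lambda>x. (X x)\<^sup>2 :: real)"
proof -
  have int: "integrable p h" for h :: "'a \<Rightarrow> real"
    by (rule integrable_measure_pmf_finite[OF assms])
  have "0 \<le> measure_pmf.variance p X" by (rule measure_pmf.variance_positive)
  also have "\<dots> = measure_pmf.expectation p (\<lambda>x. (X x)\<^sup>2) - (measure_pmf.expectation p X)\<^sup>2"
    by (rule measure_pmf.variance_eq) (rule int)+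
  finally show ?thesis by simp
qed

text \<open>Jensen's inequality is applied inside the posterior of each sample list;
  \<open>bind_posterior\<close> then turns the averaged posteriors back into the prior.\<close>

lemma posterior_mean_second_moment_le:
  assumes fin: "finite (set_pmf P)" "\<And>p. p \<in> set_pmf P \<Longrightarrow> finite (set_pmf p)"
  shows "measure_pmf.expectation (hypothesis_and_samples P n) (\<lambda>\<omega>. (posterior_mean P (snd \<omega>) f - c)\<^sup>2)
           \<le> measure_pmf.expectation P (\<lambda>p. (measure_pmf.expectation p f - c)\<^sup>2)"
proof -
  let ?J = "hypothesis_and_samples P n" and ?X = "\<lambda>p. measure_pmf.expectation p f - c"
  have finJ: "finite (set_pmf ?J)"
    by (rule finite_set_pmf_hypothesis_and_samples[OF fin])
  have finpost: "finite (set_pmf (posterior P (snd \<omega>)))" if "\<omega> \<in> set_pmf ?J" for \<omega>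
    using set_pmf_posterior_subset[of "fst \<omega>" "snd \<omega>"] that finite_subset[OF _ fin(1)] by simp
  have *: "(posterior_mean P (snd \<omega>) f - c)\<^sup>2
      \<le> measure_pmf.expectation (posterior P (snd \<omega>)) (\<lambda>p. (?X p)\<^sup>2)" if "\<omega> \<in> set_pmf ?J" for \<omega>
    using square_expectation_le[OF finpost[OF that], of ?X]
    by (simp add: posterior_mean_def integrable_measure_pmf_finite[OF finpost[OF that]])
  have "measure_pmf.expectation ?J (\<lambda>\<omega>. (posterior_mean P (snd \<omega>) f - c)\<^sup>2)
      = (\<Sum>\<omega>\<in>set_pmf ?J. pmf ?J \<omega> * (posterior_mean P (snd \<omega>) f - c)\<^sup>2)"
    by (subst integral_measure_pmf[OF finJ]) auto
  also have "\<dots> \<le> (\<Sum>\<omega>\<in>set_pmf ?J. pmf ?J \<omega> *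
      measure_pmf.expectation (posterior P (snd \<omega>)) (\<lambda>p. (?X p)\<^sup>2))"
    by (intro sum_mono mult_left_mono *) auto
  also have "\<dots> = measure_pmf.expectation (bind_pmf ?J (\<lambda>\<omega>. posterior P (snd \<omega>))) (\<lambda>p. (?X p)\<^sup>2)"
    by (subst pmf_expectation_bind[OF finJ finpost]) auto
  finally show ?thesis by (simp add: bind_posterior)
qed

lemma Chebyshev_pmf:
  fixes X :: "'a \<Rightarrow> real"
  assumes "finite (set_pmf J)" "measure_pmf.expectation J (\<lambda>\<omega>. (X \<omega>)\<^sup>2) \<le> v" "\<tau> > 0"
  shows "measure_pmf.prob J {\<omega>. \<bar>X \<omega>\<bar> > \<tau>} \<le> v / \<tau>\<^sup>2"
proof -
  have "measure_pmf.prob J {\<omega>. \<bar>X \<omega>\<bar> > \<tau>} \<le> measure_pmf.prob J {\<omega> \<in> space J. \<tau>\<^sup>2 \<le> (X \<omega>)\<^sup>2}"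
    using assms(3) by (intro measure_pmf.finite_measure_mono) (auto simp: abs_le_square_iff[symmetric])
  also have "\<dots> \<le> (\<integral>\<omega>. (X \<omega>)\<^sup>2 \<partial>J) / \<tau>\<^sup>2"
    by (rule integral_Markov_inequality_measure[where A = "{}"])
      (use assms in \<open>simp_all add: integrable_measure_pmf_finite\<close>)
  also have "\<dots> \<le> v / \<tau>\<^sup>2" using assms by (intro divide_right_mono) auto
  finally show ?thesis .
qed

lemma finite_LC_prior_hypothesis: "p \<in> set_pmf (LC_prior m) \<Longrightarrow> finite (set_pmf p)"
  using set_pmf_LC_priorD finite_LC_universe by (rule finite_subset)

lemma finite_LC_hypothesis_and_samples:
  "finite (set_pmf (hypothesis_and_samples (LC_prior m) n))"
  by (intro finite_set_pmf_hypothesis_and_samples finite_set_pmf_LC_prior finite_LC_prior_hypothesis)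

text \<open>In the main bound the first clause makes answers near the center accurate, while the
  second controls the cost of moving the center of the noise.\<close>

definition LC_typical ::
  "nat \<Rightarrow> real \<Rightarrow> ((nat \<Rightarrow> bit) \<times> bit \<Rightarrow> real)
     \<Rightarrow> ((nat \<Rightarrow> bit) \<times> bit) pmf \<times> ((nat \<Rightarrow> bit) \<times> bit) list \<Rightarrow> bool" where
  "LC_typical m \<tau> f \<omega> \<longleftrightarrow>
     \<bar>measure_pmf.expectation (fst \<omega>) f - LC_center m f\<bar> \<le> \<tau> \<and>
     \<bar>posterior_mean (LC_prior m) (snd \<omega>) f - LC_center m f\<bar> \<le> \<tau>"

text \<open>Two applications of Chebyshev's inequality with the same second moment bound. It is
  essential that \<open>f\<close> is fixed and does not depend on \<open>\<omega>\<close>.\<close>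

lemma prob_not_LC_typical:
  assumes f: "\<And>x. x \<in> LC_universe m \<Longrightarrow> 0 \<le> f x \<and> f x \<le> 1" and \<tau>: "\<tau> > 0"
  shows "measure_pmf.prob (hypothesis_and_samples (LC_prior m) n) {\<omega>. \<not> LC_typical m \<tau> f \<omega>}
           \<le> 1 / (2 * 2 ^ m * \<tau>\<^sup>2)"
proof -
  let ?P = "LC_prior m" and ?v = "1 / (4 * 2 ^ m) :: real"
  let ?J = "hypothesis_and_samples ?P n" and ?c = "LC_center m f"
  have v: "measure_pmf.expectation ?P (\<lambda>p. (measure_pmf.expectation p f - ?c)\<^sup>2) \<le> ?v"
    by (rule LC_prior_second_moment[OF f])
  have v1: "measure_pmf.expectation ?J (\<lambda>\<omega>. (measure_pmf.expectation (fst \<omega>) f - ?c)\<^sup>2) \<le> ?v"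
  proof -
    have "measure_pmf.expectation ?J (\<lambda>\<omega>. (measure_pmf.expectation (fst \<omega>) f - ?c)\<^sup>2)
        = measure_pmf.expectation (map_pmf fst ?J) (\<lambda>p. (measure_pmf.expectation p f - ?c)\<^sup>2)"
      by simp
    then show ?thesis using v by (simp only: map_fst_hypothesis_and_samples)
  qed
  have v2: "measure_pmf.expectation ?J (\<lambda>\<omega>. (posterior_mean ?P (snd \<omega>) f - ?c)\<^sup>2) \<le> ?v"
    by (rule order_trans[OF posterior_mean_second_moment_le v]) (simp_all add: finite_set_pmf_LC_prior finite_LC_prior_hypothesis)
  have "measure_pmf.prob ?J {\<omega>. \<not> LC_typical m \<tau> f \<omega>}
      \<le> measure_pmf.prob ?J ({\<omega>. \<bar>measure_pmf.expectation (fst \<omega>) f - ?c\<bar> > \<tau>}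
           \<union> {\<omega>. \<bar>posterior_mean ?P (snd \<omega>) f - ?c\<bar> > \<tau>})"
    by (intro measure_pmf.finite_measure_mono) (auto simp: LC_typical_def)
  also have "\<dots> \<le> measure_pmf.prob ?J {\<omega>. \<bar>measure_pmf.expectation (fst \<omega>) f - ?c\<bar> > \<tau>}
           + measure_pmf.prob ?J {\<omega>. \<bar>posterior_mean ?P (snd \<omega>) f - ?c\<bar> > \<tau>}"
    by (rule measure_Un_le) auto
  also have "\<dots> \<le> ?v / \<tau>\<^sup>2 + ?v / \<tau>\<^sup>2"
    by (intro add_mono Chebyshev_pmf finite_LC_hypothesis_and_samples v1 v2 \<tau>)
  finally show ?thesis by (simp add: field_simps)
qed

section \<open>Gaussian noise and adaptive paths\<close>

lemma sets_noise [simp, measurable_cong]: "sets (noise n) = sets borel"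
  by (simp add: noise_def)

lemma space_noise [simp]: "space (noise n) = UNIV"
  by (simp add: noise_def)

lemma noise_density:
  assumes "n > 0"
  shows "normal_density \<mu> (sqrt (1 / (4 * real n))) x
           = sqrt (2 * real n / pi) * exp (- 2 * real n * (x - \<mu>)\<^sup>2)"
proof -
  have "1 / sqrt (2 * pi * (1 / (4 * real n))) = sqrt (2 * real n / pi)"
  proof -
    have "2 * real n / pi = 1 / (2 * pi * (1 / (4 * real n)))" using assms by (simp add: field_simps)
    then show ?thesis by (simp only: real_sqrt_divide real_sqrt_one)
  qed
  moreover have "- (x - \<mu>)\<^sup>2 / (2 * (1 / (4 * real n))) = - 2 * real n * (x - \<mu>)\<^sup>2"
    using assms by (simp add: field_simps)
  ultimately show ?thesis
    using assms by (simp add: normal_density_def real_sqrt_pow2)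
qed

text \<open>Translation invariance of Lebesgue measure. Integrating over the answer \<open>y\<close>
  instead of the noise moves the dependence on the center into the density, so that two centers can
  be compared pointwise.\<close>

lemma nn_integral_noise_shift:
  assumes [measurable]: "G \<in> borel_measurable borel"
  shows "(\<integral>\<^sup>+x. G (c + x) \<partial>noise n)
           = (\<integral>\<^sup>+y. ennreal (normal_density c (sqrt (1 / (4 * real n))) y) * G y \<partial>lborel)"
proof -
  have "(\<integral>\<^sup>+y. ennreal (normal_density c (sqrt (1 / (4 * real n))) y) * G y \<partial>lborel)
      = (\<integral>\<^sup>+x. ennreal (normal_density c (sqrt (1 / (4 * real n))) (c + x)) * G (c + x) \<partial>lborel)"
    using nn_integral_real_affine[of "\<lambda>y. ennreal (normal_density c (sqrt (1 / (4 * real n))) y) * G y" 1 c]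
    by simp
  also have "\<dots> = (\<integral>\<^sup>+x. G (c + x) \<partial>noise n)"
    unfolding noise_def by (subst nn_integral_density) (simp_all add: normal_density_def)
  finally show ?thesis ..
qed

text \<open>Where \<open>G\<close> does not vanish, \<open>(y - c)\<^sup>2\<close> exceeds
  \<open>(y - c')\<^sup>2\<close> by at most \<open>2 * \<tau>\<close>. As the density is
  proportional to \<open>exp (- 2 * n * (y - c)\<^sup>2)\<close>, it loses at most the stated
  factor.\<close>

lemma noise_change_of_center:
  assumes n: "n > 0" and \<tau>: "0 \<le> \<tau>" "\<tau> \<le> 1" and [measurable]: "G \<in> borel_measurable borel"
    and supp: "\<And>y. G y \<noteq> 0 \<Longrightarrow> \<bar>c - c'\<bar> \<le> \<tau> \<and> \<bar>y - c'\<bar> \<le> 1 / 2"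
  shows "ennreal (exp (- 4 * real n * \<tau>)) * (\<integral>\<^sup>+x. G (c' + x) \<partial>noise n)
           \<le> (\<integral>\<^sup>+x. G (c + x) \<partial>noise n)"
proof -
  let ?d = "\<lambda>c y. normal_density c (sqrt (1 / (4 * real n))) y"
  let ?k = "exp (- 4 * real n * \<tau>)"
  have "ennreal ?k * (ennreal (?d c' y) * G y) \<le> ennreal (?d c y) * G y" for y
  proof (cases "G y = 0")
    case False
    define u d where "u = y - c'" and "d = c' - c"
    from supp[OF False] have u: "\<bar>u\<bar> \<le> 1 / 2" and d: "\<bar>d\<bar> \<le> \<tau>" by (auto simp: u_def d_def)
    have "u * d \<le> \<bar>u\<bar> * \<bar>d\<bar>" by (simp add: abs_mult[symmetric])
    also have "\<dots> \<le> (1 / 2) * \<tau>" using u d by (intro mult_mono) auto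
    finally have ud: "u * d \<le> \<tau> / 2" by simp
    have "d\<^sup>2 \<le> \<tau>\<^sup>2" using d by (metis abs_ge_zero power2_abs power_mono)
    also have "\<dots> \<le> \<tau>" using \<tau> by (simp add: power2_eq_square mult_left_le)
    finally have "d\<^sup>2 \<le> \<tau>" .
    with ud have "(u + d)\<^sup>2 \<le> u\<^sup>2 + 2 * \<tau>" by (simp add: power2_sum)
    then have "(y - c)\<^sup>2 \<le> (y - c')\<^sup>2 + 2 * \<tau>" by (simp add: u_def d_def)
    then have "2 * real n * (y - c)\<^sup>2 \<le> 2 * real n * ((y - c')\<^sup>2 + 2 * \<tau>)"
      by (intro mult_left_mono) auto
    then have "?k * exp (- 2 * real n * (y - c')\<^sup>2) \<le> exp (- 2 * real n * (y - c)\<^sup>2)"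
      by (simp add: exp_add[symmetric] algebra_simps)
    then have "sqrt (2 * real n / pi) * (?k * exp (- 2 * real n * (y - c')\<^sup>2))
        \<le> sqrt (2 * real n / pi) * exp (- 2 * real n * (y - c)\<^sup>2)"
      by (rule mult_left_mono) simp
    then have "?k * ?d c' y \<le> ?d c y" by (simp only: noise_density[OF n] mult.left_commute[of ?k])
    then have "ennreal (?k * ?d c' y) * G y \<le> ennreal (?d c y) * G y"
      by (intro mult_right_mono ennreal_leI) auto
    then show ?thesis by (simp add: ennreal_mult mult_ac)
  qed simp
  then show ?thesis
    by (simp add: nn_integral_noise_shift nn_integral_cmult[symmetric] nn_integral_mono)
qed

text \<open>The condition \<open>s\<^sup>2 \<le> s * x\<close> covers the right tail for positive
  \<open>s\<close> and the left tail for negative \<open>s\<close>. On it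
  \<open>x\<^sup>2 \<ge> (x - s)\<^sup>2 + s\<^sup>2\<close>, so the density is at most the claimed
  factor times the density centered at \<open>s\<close>, which integrates to 1.\<close>

lemma noise_tail_side:
  assumes n: "n > 0"
  shows "emeasure (noise n) {x. s\<^sup>2 \<le> s * x} \<le> ennreal (exp (- 2 * real n * s\<^sup>2))"
proof -
  let ?d = "\<lambda>c y. normal_density c (sqrt (1 / (4 * real n))) y"
  let ?k = "exp (- 2 * real n * s\<^sup>2)"
  have "emeasure (noise n) {x. s\<^sup>2 \<le> s * x} = (\<integral>\<^sup>+x. ennreal (?d 0 x) * indicator {x. s\<^sup>2 \<le> s * x} x \<partial>lborel)"
    unfolding noise_def by (subst emeasure_density) auto
  also have "\<dots> \<le> (\<integral>\<^sup>+x. ennreal ?k * ennreal (?d s x) \<partial>lborel)"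
  proof (rule nn_integral_mono)
    fix x :: real
    have "?d 0 x \<le> ?k * ?d s x" if "s\<^sup>2 \<le> s * x"
    proof -
      have "(x - s)\<^sup>2 + s\<^sup>2 \<le> x\<^sup>2" using that by (simp add: power2_eq_square algebra_simps)
      then have "2 * real n * ((x - s)\<^sup>2 + s\<^sup>2) \<le> 2 * real n * x\<^sup>2" by (intro mult_left_mono) auto
      then have "exp (- 2 * real n * x\<^sup>2) \<le> ?k * exp (- 2 * real n * (x - s)\<^sup>2)"
        by (simp add: exp_add[symmetric] algebra_simps)
      then have "sqrt (2 * real n / pi) * exp (- 2 * real n * x\<^sup>2)
          \<le> sqrt (2 * real n / pi) * (?k * exp (- 2 * real n * (x - s)\<^sup>2))"
        by (rule mult_left_mono) simp
      then show ?thesis by (simp only: noise_density[OF n] mult.left_commute[of ?k] diff_zero)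
    qed
    then show "ennreal (?d 0 x) * indicator {x. s\<^sup>2 \<le> s * x} x \<le> ennreal ?k * ennreal (?d s x)"
      by (auto simp: indicator_def ennreal_mult[symmetric] intro!: ennreal_leI)
  qed
  also have "\<dots> = ennreal ?k * (\<integral>\<^sup>+x. ennreal (?d s x) * 1 \<partial>lborel)"
    by (simp add: nn_integral_cmult)
  also have "(\<integral>\<^sup>+x. ennreal (?d s x) * 1 \<partial>lborel) = 1"
    using prob_space.emeasure_space_1[OF prob_space_noise[OF n]]
    by (subst nn_integral_noise_shift[symmetric]) simp_all
  finally show ?thesis by simp
qed

lemma noise_tail:
  assumes n: "n > 0" and t: "t \<ge> 0"
  shows "measure (noise n) {x. \<bar>x\<bar> > t} \<le> 2 * exp (- 2 * real n * t\<^sup>2)"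
proof -
  interpret prob_space "noise n" by (rule prob_space_noise[OF n])
  have side: "prob {x. s\<^sup>2 \<le> s * x} \<le> exp (- 2 * real n * s\<^sup>2)" for s
    using noise_tail_side[OF n, of s] by (simp add: emeasure_eq_measure)
  have "x \<in> {x. t\<^sup>2 \<le> t * x} \<union> {x. (- t)\<^sup>2 \<le> - t * x}" if "\<bar>x\<bar> > t" for x
  proof -
    have "t * t \<le> t * \<bar>x\<bar>" using that t by (intro mult_left_mono) auto
    then show ?thesis by (auto simp: power2_eq_square abs_if split: if_splits)
  qed
  then have "prob {x. \<bar>x\<bar> > t} \<le> prob ({x. t\<^sup>2 \<le> t * x} \<union> {x. (- t)\<^sup>2 \<le> - t * x})"
    by (intro finite_measure_mono) auto
  also have "\<dots> \<le> prob {x. t\<^sup>2 \<le> t * x} + prob {x. (- t)\<^sup>2 \<le> - t * x}"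
    by (rule measure_Un_le) auto
  also have "\<dots> \<le> 2 * exp (- 2 * real n * t\<^sup>2)"
    using side[of t] side[of "- t"] by simp
  finally show ?thesis .
qed

text \<open>The interval has length \<open>2 * \<epsilon>\<close> and stays within
  \<open>K / sqrt n\<close> of the mean, where the density is at least
  \<open>sqrt (2 * n / pi) * exp (- 2 * K\<^sup>2)\<close>.\<close>

lemma noise_interval_lower_bound:
  assumes n: "n > 0" and \<epsilon>: "\<epsilon> > 0" and K: "\<bar>d\<bar> + \<epsilon> \<le> K / sqrt (real n)"
  shows "\<epsilon> * sqrt (real n) * exp (- 2 * K\<^sup>2) \<le> measure (noise n) {x. \<bar>d - x\<bar> < \<epsilon>}"
proof -
  interpret prob_space "noise n" by (rule prob_space_noise[OF n])
  let ?d = "\<lambda>x. normal_density 0 (sqrt (1 / (4 * real n))) x"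
  let ?k = "sqrt (2 * real n / pi) * exp (- 2 * K\<^sup>2)"
  have eq: "{x. \<bar>d - x\<bar> < \<epsilon>} = {d - \<epsilon> <..< d + \<epsilon>}" by auto
  have "ennreal (?k * (2 * \<epsilon>)) = (\<integral>\<^sup>+x. ennreal ?k * indicator {d - \<epsilon> <..< d + \<epsilon>} x \<partial>lborel)"
    using \<epsilon> n by (simp add: nn_integral_cmult ennreal_mult)
  also have "\<dots> \<le> (\<integral>\<^sup>+x. ennreal (?d x) * indicator {d - \<epsilon> <..< d + \<epsilon>} x \<partial>lborel)"
  proof (rule nn_integral_mono)
    fix x :: real
    have "?k \<le> ?d x" if "x \<in> {d - \<epsilon> <..< d + \<epsilon>}"
    proof -
      have "\<bar>x\<bar> \<le> K / sqrt (real n)" using that K by auto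
      then have "\<bar>x\<bar>\<^sup>2 \<le> (K / sqrt (real n))\<^sup>2" by (intro power_mono) auto
      then have "real n * x\<^sup>2 \<le> K\<^sup>2" using n by (simp add: power_divide field_simps)
      then show ?thesis
        by (auto simp: noise_density[OF n] intro!: mult_left_mono)
    qed
    then show "ennreal ?k * indicator {d - \<epsilon> <..< d + \<epsilon>} x
        \<le> ennreal (?d x) * indicator {d - \<epsilon> <..< d + \<epsilon>} x"
      by (auto simp: indicator_def intro!: ennreal_leI)
  qed
  also have "\<dots> = emeasure (noise n) {d - \<epsilon> <..< d + \<epsilon>}"
    unfolding noise_def by (subst emeasure_density) auto
  finally have le: "?k * (2 * \<epsilon>) \<le> prob {d - \<epsilon> <..< d + \<epsilon>}"
    by (simp add: emeasure_eq_measure)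
  have "sqrt (real n) / 2 \<le> sqrt (2 * real n / pi)"
    using pi_less_4 n by (intro real_le_rsqrt) (simp add: power_divide field_simps)
  then have "(sqrt (real n) / 2) * (2 * \<epsilon> * exp (- 2 * K\<^sup>2)) \<le> sqrt (2 * real n / pi) * (2 * \<epsilon> * exp (- 2 * K\<^sup>2))"
    using \<epsilon> by (intro mult_right_mono) auto
  with le show ?thesis unfolding eq by (simp add: mult_ac)
qed

section \<open>Adaptive answer sequences as points of product spaces\<close>

text \<open>Only the entries below \<open>i\<close> of \<open>path m z i\<close> are meaningful; the rest is \<^const>\<open>undefined\<close>,
  which makes the path an element of the extensional product space.\<close>

primrec path :: "(nat \<Rightarrow> (nat \<Rightarrow> real) \<Rightarrow> real) \<Rightarrow> (nat \<Rightarrow> real) \<Rightarrow> nat \<Rightarrow> nat \<Rightarrow> real" where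
  "path m z 0 = (\<lambda>_. undefined)"
| "path m z (Suc i) = (path m z i)(i := m i (path m z i) + z i)"

abbreviation histories :: "nat \<Rightarrow> (nat \<Rightarrow> real) measure" where
  "histories i \<equiv> PiM {..<i} (\<lambda>_. borel)"

lemma sets_PiM_noise [measurable_cong]: "sets (PiM {..<i} (\<lambda>_. noise n)) = sets (histories i)"
  by (rule sets_PiM_cong) simp_all

lemma path_in_histories: "path m z i \<in> space (histories i)"
  by (induction i) (auto simp: space_PiM PiE_def extensional_def)

text \<open>Later rounds never overwrite earlier answers, so the state of the game in every round
  can be read off the final path.\<close>

lemma restrict_path: "i \<le> q \<Longrightarrow> restrict (path m z q) {..<i} = path m z i"
proof (induction q)
  case 0
  then show ?case by auto
next
  case (Suc q)
  show ?case
  proof (cases "i = Suc q")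
    case True
    then show ?thesis using path_in_histories[of m z i] by (simp add: space_PiM PiE_restrict del: path.simps)
  next
    case False
    then have "restrict (path m z q) {..<i} = path m z i"
      by (intro Suc.IH) (use Suc.prems in arith)
    moreover have "restrict (path m z (Suc q)) {..<i} = restrict (path m z q) {..<i}"
      using False Suc.prems by (auto simp: restrict_def)
    ultimately show ?thesis by (simp only:)
  qed
qed

lemma path_nth: "i < q \<Longrightarrow> path m z q i = m i (path m z i) + z i"
  using restrict_path[of "Suc i" q m z] by (auto simp: fun_eq_iff restrict_def split: if_splits dest: spec[of _ i])

lemma path_cong: "(\<And>j. j < i \<Longrightarrow> z j = z' j) \<Longrightarrow> path m z i = path m z' i"
  by (induction i) auto

text \<open>The means may depend on the parameter \<open>w\<close>. This serves both for noise alone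
  and for noise paired with the seed of the analyst.\<close>

lemma measurable_path:
  assumes Z: "\<And>j. j < i \<Longrightarrow> (\<lambda>w. Z w j) \<in> borel_measurable N"
    and m: "\<And>j. j < i \<Longrightarrow> (\<lambda>(w, a). m w j a) \<in> borel_measurable (N \<Otimes>\<^sub>M histories j)"
  shows "(\<lambda>w. path (m w) (Z w) i) \<in> measurable N (histories i)"
  using assms
proof (induction i)
  case 0
  then show ?case by (simp add: space_PiM)
next
  case (Suc i)
  have [measurable]: "(\<lambda>w. path (m w) (Z w) i) \<in> measurable N (histories i)"
    by (rule Suc.IH) (use Suc.prems in auto)
  have [measurable]: "(\<lambda>w. Z w i) \<in> borel_measurable N"
    "(\<lambda>(w, a). m w i a) \<in> borel_measurable (N \<Otimes>\<^sub>M histories i)"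
    using Suc.prems by auto
  have "(\<lambda>w. m w i (path (m w) (Z w) i)) = (\<lambda>(w, a). m w i a) \<circ> (\<lambda>w. (w, path (m w) (Z w) i))"
    by auto
  then have [measurable]: "(\<lambda>w. m w i (path (m w) (Z w) i)) \<in> borel_measurable N"
    by (simp only:) (rule measurable_comp[of _ _ "N \<Otimes>\<^sub>M histories i"], measurable)
  show ?case
    unfolding path.simps by (rule measurable_fun_upd[where J = "{..<i}"]) (auto simp: lessThan_Suc)
qed

lemma measurable_path_noise:
  assumes "\<And>j. j < i \<Longrightarrow> m j \<in> borel_measurable (histories j)" and "i \<le> q"
  shows "(\<lambda>z. path m z i) \<in> measurable (PiM {..<q} (\<lambda>_. noise n)) (histories i)"
proof (rule measurable_path)
  fix j assume j: "j < i"
  show "(\<lambda>z. z j) \<in> borel_measurable (PiM {..<q} (\<lambda>_. noise n))"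
    using measurable_component_singleton[of j "{..<q}" "\<lambda>_. noise n"] j assms(2)
    by (simp cong: measurable_cong_sets)
  have [measurable]: "m j \<in> borel_measurable (histories j)" using assms(1) j .
  show "(\<lambda>(z :: nat \<Rightarrow> real, a). m j a) \<in> borel_measurable (PiM {..<q} (\<lambda>_. noise n) \<Otimes>\<^sub>M histories j)"
    by measurable
qed

text \<open>Induction on the number of rounds, peeling off the last one. Each round costs one factor
  from \<open>noise_change_of_center\<close>. \<open>F\<close> must be arbitrary, because
  integrating out the last answer yields a new functional of the shorter history.\<close>

lemma path_change_of_center:
  assumes n: "n > 0" and \<tau>: "0 \<le> \<tau>" "\<tau> \<le> 1"
    and m: "\<And>i. i < q \<Longrightarrow> m i \<in> borel_measurable (histories i)"
    and c: "\<And>i. i < q \<Longrightarrow> c i \<in> borel_measurable (histories i)"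
    and F: "F \<in> borel_measurable (histories q)"
    and supp: "\<And>a i. a \<in> space (histories q) \<Longrightarrow> F a \<noteq> 0 \<Longrightarrow> i < q \<Longrightarrow>
      \<bar>m i (restrict a {..<i}) - c i (restrict a {..<i})\<bar> \<le> \<tau> \<and> \<bar>a i - c i (restrict a {..<i})\<bar> \<le> 1 / 2"
  shows "ennreal (exp (- 4 * real n * \<tau>)) ^ q * (\<integral>\<^sup>+z. F (path c z q) \<partial>PiM {..<q} (\<lambda>_. noise n))
           \<le> (\<integral>\<^sup>+z. F (path m z q) \<partial>PiM {..<q} (\<lambda>_. noise n))"
  using m c F supp
proof (induction q arbitrary: F)
  case 0
  then show ?case by simp
next
  case (Suc q)
  interpret noise: prob_space "noise n" by (rule prob_space_noise[OF n])
  interpret product_sigma_finite "\<lambda>_. noise n" by standard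
  let ?N = "\<lambda>q. PiM {..<q} (\<lambda>_. noise n)"
  let ?k = "ennreal (exp (- 4 * real n * \<tau>))"
  let ?I = "\<lambda>m a. \<integral>\<^sup>+x. F (a(q := m q a + x)) \<partial>noise n"
  note F = Suc.prems(3)
  have upd: "(\<lambda>(a, y). a(q := y)) \<in> measurable (histories q \<Otimes>\<^sub>M borel) (histories (Suc q))"
    using measurable_add_dim[of q "{..<q}" "\<lambda>_. borel"] by (simp add: lessThan_Suc)
  have Fupd [measurable]: "(\<lambda>(a, y). F (a(q := y))) \<in> borel_measurable (histories q \<Otimes>\<^sub>M borel)"
    using measurable_compose[OF upd F] by (simp add: case_prod_unfold fun_upd_def)
  have meas_I: "?I h \<in> borel_measurable (histories q)" if [measurable]: "h q \<in> borel_measurable (histories q)" for h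
  proof -
    have "(\<lambda>(a, x). (a, h q a + x)) \<in> measurable (histories q \<Otimes>\<^sub>M noise n) (histories q \<Otimes>\<^sub>M borel)"
      by measurable
    from measurable_compose[OF this Fupd]
    have "(\<lambda>(a, x). F (a(q := h q a + x))) \<in> borel_measurable (histories q \<Otimes>\<^sub>M noise n)"
      by (simp add: case_prod_unfold)
    then show ?thesis by (rule noise.borel_measurable_nn_integral)
  qed
  \<comment> \<open>Tonelli for the last noise value, on which the first \<open>q\<close> answers do
    not depend.\<close>
  have unroll: "(\<integral>\<^sup>+z. F (path h z (Suc q)) \<partial>?N (Suc q)) = (\<integral>\<^sup>+z. ?I h (path h z q) \<partial>?N q)"
    if h: "\<And>i. i < Suc q \<Longrightarrow> h i \<in> borel_measurable (histories i)" for h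
  proof -
    have "(\<lambda>z. F (path h z (Suc q))) \<in> borel_measurable (?N (Suc q))"
      by (rule measurable_compose[OF measurable_path_noise F]) (use h in auto)
    then have "(\<integral>\<^sup>+z. F (path h z (Suc q)) \<partial>?N (Suc q))
        = (\<integral>\<^sup>+z. \<integral>\<^sup>+x. F (path h (z(q := x)) (Suc q)) \<partial>noise n \<partial>?N q)"
      unfolding lessThan_Suc by (intro product_nn_integral_insert) auto
    moreover have "path h (z(q := x)) q = path h z q" for z x
      by (rule path_cong) simp
    ultimately show ?thesis by simp
  qed
  have step: "?k * ?I c a \<le> ?I m a" if a: "a \<in> space (histories q)" for a
  proof (rule noise_change_of_center[OF n \<tau>])
    show "(\<lambda>y. F (a(q := y))) \<in> borel_measurable borel"
      using measurable_Pair2[OF Fupd a] by simp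
    fix y assume y: "F (a(q := y)) \<noteq> 0"
    have b: "a(q := y) \<in> space (histories (Suc q))"
      using a by (auto simp: space_PiM PiE_def extensional_def)
    have restr: "restrict (a(q := y)) {..<q} = a"
      using a by (auto simp: space_PiM PiE_def extensional_def restrict_def)
    show "\<bar>m q a - c q a\<bar> \<le> \<tau> \<and> \<bar>y - c q a\<bar> \<le> 1 / 2"
      using Suc.prems(4)[OF b y lessI] by (simp only: restr fun_upd_same)
  qed
  \<comment> \<open>The first \<open>q\<close> rounds are changed while the last one still uses
    \<open>c\<close>; afterwards \<open>step\<close> changes the last round pointwise along the path
    of \<open>m\<close>.\<close>
  have "?k ^ q * (\<integral>\<^sup>+z. ?I c (path c z q) \<partial>?N q) \<le> (\<integral>\<^sup>+z. ?I c (path m z q) \<partial>?N q)"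
  proof (rule Suc.IH)
    fix a i assume a: "a \<in> space (histories q)" "?I c a \<noteq> 0" and i: "i < q"
    \<comment> \<open>A nonzero integral has a nonzero integrand somewhere, so the history extends
      to a point where \<open>F\<close> does not vanish and inherits its support condition.\<close>
    have "\<exists>x. F (a(q := c q a + x)) \<noteq> 0"
    proof (rule ccontr)
      assume "\<nexists>x. F (a(q := c q a + x)) \<noteq> 0"
      then have "?I c a = 0" by simp
      with a show False by simp
    qed
    then obtain y where y: "F (a(q := y)) \<noteq> 0" by blast
    have b: "a(q := y) \<in> space (histories (Suc q))"
      using a by (auto simp: space_PiM PiE_def extensional_def)
    have restr: "restrict (a(q := y)) {..<i} = restrict a {..<i}" and nth: "(a(q := y)) i = a i"
      using i by (auto simp: restrict_def)
    show "\<bar>m i (restrict a {..<i}) - c i (restrict a {..<i})\<bar> \<le> \<tau> \<and> \<bar>a i - c i (restrict a {..<i})\<bar> \<le> 1 / 2"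
      using Suc.prems(4)[OF b y less_SucI[OF i]] by (simp only: restr nth)
  qed (intro meas_I Suc.prems(1,2) less_SucI lessI; assumption)+
  then have "?k * (?k ^ q * (\<integral>\<^sup>+z. ?I c (path c z q) \<partial>?N q)) \<le> ?k * (\<integral>\<^sup>+z. ?I c (path m z q) \<partial>?N q)"
    by (rule mult_left_mono) simp
  also have "\<dots> = (\<integral>\<^sup>+z. ?k * ?I c (path m z q) \<partial>?N q)"
    by (intro nn_integral_cmult[symmetric] measurable_compose[OF measurable_path_noise meas_I])
      (use Suc.prems in auto)
  also have "\<dots> \<le> (\<integral>\<^sup>+z. ?I m (path m z q) \<partial>?N q)"
    by (intro nn_integral_mono step path_in_histories)
  finally show ?case
    using Suc.prems by (simp only: unroll power_Suc mult.assoc)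
qed

section \<open>The game\<close>

lemma answers_eq_path:
  "answers P xs z t i = map (path (\<lambda>i a. posterior_mean P xs (t (map a [0..<i]))) z i) [0..<i]"
proof (induction i)
  case (Suc i)
  then show ?case by (simp add: Let_def)
qed simp

lemma all_accurate_iff_path:
  assumes "m = (\<lambda>i a. posterior_mean P xs (t (map a [0..<i])))"
  shows "all_accurate P \<epsilon> q p xs z t \<longleftrightarrow>
    (\<forall>i<q. \<bar>measure_pmf.expectation p (t (map (path m z i) [0..<i])) - (m i (path m z i) + z i)\<bar> < \<epsilon>)"
proof -
  have "answers P xs z t (Suc i) ! i = m i (path m z i) + z i" for i
    by (simp add: answers_eq_path assms nth_append del: upt_Suc)
  then show ?thesis
    by (simp add: all_accurate_def accurate_def answers_eq_path[of P xs z t] assms[symmetric] del: answers.simps)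
qed

text \<open>Every hypothesis lives on the finite universe, so the expectation is a finite sum and
  measurability at each point suffices.\<close>

lemma measurable_expectation_LC:
  assumes "\<And>x. x \<in> LC_universe n \<Longrightarrow> (\<lambda>w. g w x) \<in> borel_measurable N" and "p \<in> set_pmf (LC_prior n)"
  shows "(\<lambda>w. measure_pmf.expectation p (g w) :: real) \<in> borel_measurable N"
proof -
  have "(\<lambda>w. measure_pmf.expectation p (g w)) = (\<lambda>w. \<Sum>x\<in>LC_universe n. g w x * pmf p x)"
    using set_pmf_LC_priorD[OF assms(2)]
    by (intro ext integral_measure_pmf_real finite_LC_universe) auto
  then show ?thesis using assms(1) by simp
qed

lemma measurable_posterior_mean_LC:
  assumes "\<And>x. x \<in> LC_universe n \<Longrightarrow> (\<lambda>w. g w x) \<in> borel_measurable N"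
    and "(p, xs) \<in> set_pmf (hypothesis_and_samples (LC_prior n) k)"
  shows "(\<lambda>w. posterior_mean (LC_prior n) xs (g w)) \<in> borel_measurable N"
proof -
  have "(\<lambda>w. posterior_mean (LC_prior n) xs (g w)) =
      (\<lambda>w. \<Sum>p\<in>set_pmf (LC_prior n). measure_pmf.expectation p (g w) * pmf (posterior (LC_prior n) xs) p)"
    unfolding posterior_mean_def using set_pmf_posterior_subset[OF assms(2)]
    by (intro ext integral_measure_pmf_real finite_set_pmf_LC_prior) auto
  moreover have "(\<lambda>w. measure_pmf.expectation p (g w)) \<in> borel_measurable N" if "p \<in> set_pmf (LC_prior n)" for p
    using measurable_expectation_LC[OF assms(1) that] .
  ultimately show ?thesis by simp
qed

lemma measurable_LC_center:
  assumes "\<And>x. x \<in> LC_universe n \<Longrightarrow> (\<lambda>w. g w x) \<in> borel_measurable N"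
  shows "(\<lambda>w. LC_center n (g w)) \<in> borel_measurable N"
proof -
  have [measurable]: "(\<lambda>w. g w (y, c)) \<in> borel_measurable N" if "y \<in> F2_vectors n" for y c
    using assms that by (simp add: LC_universe_def)
  show ?thesis unfolding LC_center_def by measurable
qed

lemma sum_pmf_indicator:
  assumes "finite (set_pmf J)"
  shows "(\<Sum>\<omega>\<in>set_pmf J. indicator A \<omega> * ennreal (pmf J \<omega>)) = ennreal (measure_pmf.prob J A)"
proof -
  have "(\<Sum>\<omega>\<in>set_pmf J. indicator A \<omega> * ennreal (pmf J \<omega>)) = (\<integral>\<^sup>+\<omega>. indicator A \<omega> \<partial>J)"
    by (rule nn_integral_measure_pmf_finite[symmetric]) (use assms in auto)
  then show ?thesis by (simp add: measure_pmf.emeasure_eq_measure)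
qed

text \<open>The game for one frozen seed: \<open>t\<close> is a deterministic strategy. The seed is
  averaged out only at the end.\<close>

locale LC_game =
  fixes n q :: nat and t :: "real list \<Rightarrow> (nat \<Rightarrow> bit) \<times> bit \<Rightarrow> real"
  assumes n_pos: "n > 0"
    and range: "\<And>h x. x \<in> LC_universe n \<Longrightarrow> length h < q \<Longrightarrow> 0 \<le> t h x \<and> t h x \<le> 1"
    and meas: "\<And>i x. i < q \<Longrightarrow> x \<in> LC_universe n \<Longrightarrow> (\<lambda>a. t (map a [0..<i]) x) \<in> borel_measurable (histories i)"
begin

abbreviation "J \<equiv> hypothesis_and_samples (LC_prior n) n"
abbreviation "N \<equiv> PiM {..<q} (\<lambda>_. noise n)"
abbreviation "query i a \<equiv> t (map a [0..<i])"
abbreviation "curator xs \<equiv> \<lambda>i a. posterior_mean (LC_prior n) xs (query i a)"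
abbreviation "center \<equiv> \<lambda>i a. LC_center n (query i a)"

text \<open>The support of \<open>J\<close> is finite, so averaging over hypothesis and samples is a
  finite sum, easily exchanged with the integral over the noise.\<close>

definition success_prob :: "real \<Rightarrow> ennreal" where
  "success_prob \<epsilon> = (\<Sum>\<omega>\<in>set_pmf J.
     emeasure N {z \<in> space N. all_accurate (LC_prior n) \<epsilon> q (fst \<omega>) (snd \<omega>) z t} * ennreal (pmf J \<omega>))"

lemma measurable_center: "i < q \<Longrightarrow> center i \<in> borel_measurable (histories i)"
  by (rule measurable_LC_center) (rule meas)

lemma measurable_curator:
  "\<omega> \<in> set_pmf J \<Longrightarrow> i < q \<Longrightarrow> curator (snd \<omega>) i \<in> borel_measurable (histories i)"
  by (rule measurable_posterior_mean_LC[of n _ _ "fst \<omega>"]) (auto intro: meas)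

lemma measurable_truth:
  "\<omega> \<in> set_pmf J \<Longrightarrow> i < q \<Longrightarrow>
     (\<lambda>a. measure_pmf.expectation (fst \<omega>) (query i a)) \<in> borel_measurable (histories i)"
  by (rule measurable_expectation_LC)
    (auto intro: meas hypothesis_and_samplesD(1)[of "fst \<omega>" "snd \<omega>"])

lemma query_restrict: "i \<le> j \<Longrightarrow> query i (restrict a {..<j}) = query i a"
  by (intro arg_cong[where f = t]) simp

lemma sets_all_accurate:
  assumes \<omega>: "\<omega> \<in> set_pmf J"
  shows "{z \<in> space N. all_accurate (LC_prior n) \<epsilon> q (fst \<omega>) (snd \<omega>) z t} \<in> sets N"
proof -
  have [measurable]: "(\<lambda>z. measure_pmf.expectation (fst \<omega>) (query i (path (curator (snd \<omega>)) z i))) \<in> borel_measurable N"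
    "(\<lambda>z. curator (snd \<omega>) i (path (curator (snd \<omega>)) z i)) \<in> borel_measurable N"
    "(\<lambda>z. z i) \<in> borel_measurable N" if "i \<in> {..<q}" for i
  proof -
    from that have i: "i < q" by simp
    have "(\<lambda>z. path (curator (snd \<omega>)) z i) \<in> measurable N (histories i)"
      using i by (intro measurable_path_noise measurable_curator[OF \<omega>]) auto
    note p = measurable_compose[OF this]
    show "(\<lambda>z. measure_pmf.expectation (fst \<omega>) (query i (path (curator (snd \<omega>)) z i))) \<in> borel_measurable N"
      by (rule p[OF measurable_truth[OF \<omega> i]])
    show "(\<lambda>z. curator (snd \<omega>) i (path (curator (snd \<omega>)) z i)) \<in> borel_measurable N"
      by (rule p[OF measurable_curator[OF \<omega> i]])
    show "(\<lambda>z. z i) \<in> borel_measurable N"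
      using measurable_component_singleton[OF that, of "\<lambda>_. noise n"] by (simp cong: measurable_cong_sets)
  qed
  have "{z \<in> space N. all_accurate (LC_prior n) \<epsilon> q (fst \<omega>) (snd \<omega>) z t} =
    {z \<in> space N. \<forall>i\<in>{..<q}. \<bar>measure_pmf.expectation (fst \<omega>) (query i (path (curator (snd \<omega>)) z i))
       - (curator (snd \<omega>) i (path (curator (snd \<omega>)) z i) + z i)\<bar> < \<epsilon>}"
    by (simp add: all_accurate_iff_path[OF refl] Ball_def)
  also have "\<dots> \<in> sets N" by measurable
  finally show ?thesis .
qed

text \<open>Independence gives the \<open>q\<close>-th power of the one-coordinate probability, and
  Bernoulli's inequality linearises it.\<close>

lemma prob_small_noise:
  assumes "s \<ge> 0"
  shows "ennreal (1 - real q * (2 * exp (- 2 * real n * s\<^sup>2))) \<le> emeasure N {z \<in> space N. \<forall>i<q. \<bar>z i\<bar> \<le> s}"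
proof -
  interpret noise: prob_space "noise n" by (rule prob_space_noise[OF n_pos])
  interpret product_sigma_finite "\<lambda>_. noise n" by standard
  let ?p = "measure (noise n) {x. \<bar>x\<bar> \<le> s}"
  have "?p = 1 - measure (noise n) {x. \<bar>x\<bar> > s}"
    using noise.prob_neg[of "\<lambda>x. \<bar>x\<bar> > s"] by (simp add: not_less)
  with noise_tail[OF n_pos assms] have p: "1 - 2 * exp (- 2 * real n * s\<^sup>2) \<le> ?p" by linarith
  have "1 - real q * (2 * exp (- 2 * real n * s\<^sup>2)) = 1 + real q * ((1 - 2 * exp (- 2 * real n * s\<^sup>2)) - 1)"
    by (simp add: algebra_simps)
  also have "\<dots> \<le> 1 + real q * (?p - 1)"
    using p by (intro add_left_mono mult_left_mono) auto
  also have "\<dots> \<le> (1 + (?p - 1)) ^ q"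
    by (rule Bernoulli_inequality) simp
  finally have "ennreal (1 - real q * (2 * exp (- 2 * real n * s\<^sup>2))) \<le> ennreal (?p ^ q)"
    by (intro ennreal_leI) simp
  also have "\<dots> = emeasure N (PiE {..<q} (\<lambda>_. {x. \<bar>x\<bar> \<le> s}))"
    by (subst emeasure_PiM) (auto simp: noise.emeasure_eq_measure ennreal_power)
  also have "PiE {..<q} (\<lambda>_. {x. \<bar>x\<bar> \<le> s}) = {z \<in> space N. \<forall>i<q. \<bar>z i\<bar> \<le> s}"
    by (auto simp: space_PiM PiE_def Pi_def)
  finally show ?thesis .
qed

text \<open>As \<open>a\<close> is chosen independently of \<open>\<omega>\<close>, the queries read
  off from it are \<open>q\<close> fixed functions, and a union bound applies.\<close>

lemma prob_always_typical:
  assumes "\<tau> > 0"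
  shows "1 - real q * (1 / (2 * 2 ^ n * \<tau>\<^sup>2))
           \<le> measure_pmf.prob J {\<omega>. \<forall>i<q. LC_typical n \<tau> (query i a) \<omega>}"
proof -
  let ?B = "\<lambda>i. {\<omega>. \<not> LC_typical n \<tau> (query i a) \<omega>}"
  have "measure_pmf.prob J (\<Union>i\<in>{..<q}. ?B i) \<le> (\<Sum>i<q. measure_pmf.prob J (?B i))"
    by (rule measure_pmf.finite_measure_subadditive_finite) auto
  also have "\<dots> \<le> (\<Sum>i<q. 1 / (2 * 2 ^ n * \<tau>\<^sup>2))"
    by (intro sum_mono prob_not_LC_typical assms range) auto
  finally have "measure_pmf.prob J (\<Union>i\<in>{..<q}. ?B i) \<le> real q * (1 / (2 * 2 ^ n * \<tau>\<^sup>2))" by simp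
  moreover have "{\<omega>. \<forall>i<q. LC_typical n \<tau> (query i a) \<omega>} = UNIV - (\<Union>i\<in>{..<q}. ?B i)" by auto
  ultimately show ?thesis
    using measure_pmf.prob_compl[of "\<Union>i\<in>{..<q}. ?B i" J] by simp
qed

text \<open>
  Against the curator who answers with the center plus noise, the queries do not depend on \<open>\<omega>\<close>, so for
  fixed noise \<open>prob_always_typical\<close> applies to them. The factor \<open>exp (- 4 n \<tau>) ^ q\<close> pays for
  replacing the real curator by this one.
\<close>

lemma success_prob_ge:
  assumes \<tau>: "0 < \<tau>" "\<tau> < \<epsilon> / 2" and \<epsilon>: "\<epsilon> \<le> 1"
  shows "ennreal (exp (- 4 * real n * \<tau>)) ^ q * (ennreal (1 - real q * (1 / (2 * 2 ^ n * \<tau>\<^sup>2)))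
           * ennreal (1 - real q * (2 * exp (- 2 * real n * (\<epsilon> / 2)\<^sup>2)))) \<le> success_prob \<epsilon>"
proof -
  let ?k = "ennreal (exp (- 4 * real n * \<tau>)) ^ q"
  let ?\<beta> = "1 - real q * (1 / (2 * 2 ^ n * \<tau>\<^sup>2))"
  \<comment> \<open>The good answer histories for \<open>\<omega>\<close>: every query typical,
    every answer within \<open>\<epsilon> / 2\<close> of its center. The event refers to answers
    rather than noise, so that it can be compared across the two curators.\<close>
  let ?G = "\<lambda>\<omega>. {a \<in> space (histories q). \<forall>i\<in>{..<q}.
      LC_typical n \<tau> (query i (restrict a {..<i})) \<omega> \<and> \<bar>a i - center i (restrict a {..<i})\<bar> \<le> \<epsilon> / 2}"
  let ?F = "\<lambda>\<omega>. indicator (?G \<omega>) :: (nat \<Rightarrow> real) \<Rightarrow> ennreal"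
  let ?S = "{z \<in> space N. \<forall>i<q. \<bar>z i\<bar> \<le> \<epsilon> / 2}"
  have F: "?F \<omega> \<in> borel_measurable (histories q)" if \<omega>: "\<omega> \<in> set_pmf J" for \<omega>
  proof -
    have [measurable]: "(\<lambda>a. measure_pmf.expectation (fst \<omega>) (query i (restrict a {..<i}))) \<in> borel_measurable (histories q)"
      "(\<lambda>a. curator (snd \<omega>) i (restrict a {..<i})) \<in> borel_measurable (histories q)"
      "(\<lambda>a. center i (restrict a {..<i})) \<in> borel_measurable (histories q)"
      "(\<lambda>a. a i) \<in> borel_measurable (histories q)" if "i \<in> {..<q}" for i
    proof -
      from that have "(\<lambda>a. restrict a {..<i}) \<in> measurable (histories q) (histories i)"
        by (intro measurable_restrict_subset) auto
      note c = measurable_compose[OF this]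
      from that have i: "i < q" by simp
      show "(\<lambda>a. measure_pmf.expectation (fst \<omega>) (query i (restrict a {..<i}))) \<in> borel_measurable (histories q)"
        by (rule c[OF measurable_truth[OF \<omega> i]])
      show "(\<lambda>a. curator (snd \<omega>) i (restrict a {..<i})) \<in> borel_measurable (histories q)"
        by (rule c[OF measurable_curator[OF \<omega> i]])
      show "(\<lambda>a. center i (restrict a {..<i})) \<in> borel_measurable (histories q)"
        by (rule c[OF measurable_center[OF i]])
      show "(\<lambda>a. a i) \<in> borel_measurable (histories q)"
        using that by (intro measurable_component_singleton)
    qed
    show ?thesis
      unfolding LC_typical_def by (intro borel_measurable_indicator) measurable
  qed
  have lower: "?k * (\<integral>\<^sup>+z. ?F \<omega> (path center z q) \<partial>N)
      \<le> emeasure N {z \<in> space N. all_accurate (LC_prior n) \<epsilon> q (fst \<omega>) (snd \<omega>) z t}"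
    if \<omega>: "\<omega> \<in> set_pmf J" for \<omega>
  proof -
    let ?m = "curator (snd \<omega>)"
    have "?k * (\<integral>\<^sup>+z. ?F \<omega> (path center z q) \<partial>N) \<le> (\<integral>\<^sup>+z. ?F \<omega> (path ?m z q) \<partial>N)"
    proof (rule path_change_of_center[OF n_pos _ _ measurable_curator[OF \<omega>] measurable_center F[OF \<omega>]])
      fix a i assume a: "?F \<omega> a \<noteq> 0" and i: "i < q"
      have "a \<in> ?G \<omega>" using a by (rule contrapos_np) (rule indicator_simps(2))
      with i have "LC_typical n \<tau> (query i (restrict a {..<i})) \<omega>"
        "\<bar>a i - center i (restrict a {..<i})\<bar> \<le> \<epsilon> / 2" by blast+
      then show "\<bar>?m i (restrict a {..<i}) - center i (restrict a {..<i})\<bar> \<le> \<tau> \<and>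
          \<bar>a i - center i (restrict a {..<i})\<bar> \<le> 1 / 2"
        using \<epsilon> unfolding LC_typical_def by linarith
    qed (use \<tau> \<epsilon> in auto)
    also have "\<dots> \<le> (\<integral>\<^sup>+z. indicator {z \<in> space N. all_accurate (LC_prior n) \<epsilon> q (fst \<omega>) (snd \<omega>) z t} z \<partial>N)"
    proof (intro nn_integral_mono)
      fix z assume z: "z \<in> space N"
      have "all_accurate (LC_prior n) \<epsilon> q (fst \<omega>) (snd \<omega>) z t" if G: "path ?m z q \<in> ?G \<omega>"
        unfolding all_accurate_iff_path[OF refl]
      proof (intro allI impI)
        fix i assume i: "i < q"
        from G i have "LC_typical n \<tau> (query i (path ?m z i)) \<omega>"
          "\<bar>path ?m z q i - center i (path ?m z i)\<bar> \<le> \<epsilon> / 2"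
          using restrict_path[of i q ?m z] by force+
        \<comment> \<open>The truth is within \<open>\<tau> < \<epsilon> / 2\<close> of the center
          and the answer within \<open>\<epsilon> / 2\<close> of it.\<close>
        then show "\<bar>measure_pmf.expectation (fst \<omega>) (query i (path ?m z i)) - (?m i (path ?m z i) + z i)\<bar> < \<epsilon>"
          using \<tau> unfolding LC_typical_def path_nth[OF i] by linarith
      qed
      then show "?F \<omega> (path ?m z q) \<le> indicator {z \<in> space N. all_accurate (LC_prior n) \<epsilon> q (fst \<omega>) (snd \<omega>) z t} z"
        using z by (auto simp: indicator_def)
    qed
    finally show ?thesis using sets_all_accurate[OF \<omega>] by simp
  qed
  have pathm: "(\<lambda>z. path center z q) \<in> measurable N (histories q)"
    by (rule measurable_path_noise) (auto intro: measurable_center)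
  have F': "(\<lambda>z. ?F \<omega> (path center z q)) \<in> borel_measurable N" if "\<omega> \<in> set_pmf J" for \<omega>
    by (rule measurable_compose[OF pathm F[OF that]])
  have S: "?S \<in> sets N"
  proof -
    have [measurable]: "(\<lambda>z. z i) \<in> borel_measurable N" if "i \<in> {..<q}" for i
      using measurable_component_singleton[OF that, of "\<lambda>_. noise n"] by (simp cong: measurable_cong_sets)
    have "{z \<in> space N. \<forall>i\<in>{..<q}. \<bar>z i\<bar> \<le> \<epsilon> / 2} \<in> sets N" by measurable
    then show ?thesis by (simp add: Ball_def)
  qed
  have "?k * (ennreal ?\<beta> * ennreal (1 - real q * (2 * exp (- 2 * real n * (\<epsilon> / 2)\<^sup>2))))
      \<le> ?k * (ennreal ?\<beta> * emeasure N ?S)"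
    using \<tau> by (intro mult_left_mono prob_small_noise) auto
  also have "\<dots> = ?k * (\<integral>\<^sup>+z. ennreal ?\<beta> * indicator ?S z \<partial>N)"
    using S by (simp add: nn_integral_cmult_indicator)
  also have "\<dots> \<le> ?k * (\<integral>\<^sup>+z. (\<Sum>\<omega>\<in>set_pmf J. ?F \<omega> (path center z q) * ennreal (pmf J \<omega>)) \<partial>N)"
  proof (intro mult_left_mono nn_integral_mono)
    fix z assume z: "z \<in> space N"
    show "ennreal ?\<beta> * indicator ?S z \<le> (\<Sum>\<omega>\<in>set_pmf J. ?F \<omega> (path center z q) * ennreal (pmf J \<omega>))"
    proof (cases "z \<in> ?S")
      case True
      let ?a = "path center z q"
      let ?T = "{\<omega>. \<forall>i<q. LC_typical n \<tau> (query i ?a) \<omega>}"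
      \<comment> \<open>On the path of the center curator the distance from answer to center is
        exactly the noise. Small noise thus reduces membership in \<open>?G\<close> to
        typicality.\<close>
      have "indicator ?T \<omega> = ?F \<omega> ?a" for \<omega>
      proof -
        have "\<bar>?a i - center i (restrict ?a {..<i})\<bar> \<le> \<epsilon> / 2" if "i < q" for i
          using True that by (simp add: restrict_path path_nth)
        then have "\<omega> \<in> ?T \<longleftrightarrow> ?a \<in> ?G \<omega>"
          using path_in_histories[of center z q] by (auto simp: query_restrict)
        then show ?thesis by (simp add: indicator_def)
      qed
      then have "(\<Sum>\<omega>\<in>set_pmf J. ?F \<omega> ?a * ennreal (pmf J \<omega>)) = ennreal (measure_pmf.prob J ?T)"
        by (simp only: sum_pmf_indicator[OF finite_LC_hypothesis_and_samples, symmetric])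
      then show ?thesis
        using prob_always_typical[OF \<tau>(1), of ?a] True by (simp add: ennreal_leI)
    qed simp
  qed simp
  also have "\<dots> = (\<Sum>\<omega>\<in>set_pmf J. (?k * (\<integral>\<^sup>+z. ?F \<omega> (path center z q) \<partial>N)) * ennreal (pmf J \<omega>))"
    using F' by (subst nn_integral_sum) (auto simp: nn_integral_multc sum_distrib_left mult.assoc)
  also have "\<dots> \<le> success_prob \<epsilon>"
    unfolding success_prob_def by (intro sum_mono mult_right_mono lower) auto
  finally show ?thesis .
qed

end

section \<open>From the bounds to the theorem\<close>

lemma mult_one_minus_ge:
  fixes x y w X :: real
  assumes "0 \<le> x" "0 \<le> y" "0 \<le> w" "x + y + w \<le> 1" "1 - x \<le> X"
  shows "1 - (x + y + w) \<le> X * ((1 - y) * (1 - w))"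
proof -
  have yw: "1 - y - w \<le> (1 - y) * (1 - w)" using assms by (simp add: algebra_simps)
  have "1 - (x + y + w) \<le> (1 - x) * (1 - y - w)"
    using mult_nonneg_nonneg[of x "y + w"] assms by (simp add: algebra_simps)
  also have "\<dots> \<le> X * ((1 - y) * (1 - w))"
    using assms yw by (intro mult_mono) auto
  finally show ?thesis .
qed

context LC_game
begin

text \<open>The losses \<open>x\<close> (change of center), \<open>y\<close> (atypical queries) and
  \<open>w\<close> (Gaussian tail) are at most 40, 1 and 2 times \<open>q * exp (- u)\<close>, which
  adds up to the factor 43.\<close>

lemma success_prob_ge_if_enough_samples:
  assumes \<epsilon>: "0 < \<epsilon>" "\<epsilon> \<le> 1" and q: "q \<ge> 1"
    and \<delta>: "43 * real q * exp (- real n * \<epsilon>\<^sup>2 / 10) \<le> \<delta>" "\<delta> < 1"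
  shows "ennreal (1 - \<delta>) \<le> success_prob \<epsilon>"
proof -
  define u where "u = real n * \<epsilon>\<^sup>2 / 10"
  \<comment> \<open>The rate 1/5 balances two demands: \<open>n * \<tau>\<close> must decay like
    \<open>exp (- n / 10)\<close> up to a constant, and \<open>2 ^ n * \<tau>\<^sup>2\<close> must
    grow at least like \<open>exp (n / 10)\<close>.\<close>
  define \<tau> where "\<tau> = exp (- real n / 5)"
  have E: "exp (- real n * \<epsilon>\<^sup>2 / 10) = exp (- u)" by (simp add: u_def)
  have n0: "real n > 0" using n_pos by simp
  have "\<epsilon>\<^sup>2 \<le> 1" using \<epsilon> by (simp add: power_le_one)
  then have u_le: "u \<le> real n / 10" using n0 by (simp add: u_def mult_left_le)
  \<comment> \<open>Otherwise \<open>exp u \<le> 27\<close>, and the assumed bound would force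
    \<open>\<delta> \<ge> 1\<close>. The resulting \<open>n * \<epsilon> > 30\<close> yields
    \<open>\<tau> < \<epsilon> / 2\<close>.\<close>
  have u3: "u > 3"
  proof (rule ccontr)
    assume "\<not> u > 3"
    then have "exp u \<le> exp (3 * 1)" by simp
    also have "\<dots> = exp 1 ^ 3" unfolding exp_of_nat_mult[symmetric] by simp
    also have "\<dots> \<le> 3 ^ 3" using exp_le by (intro power_mono) auto
    finally have "1 \<le> 43 * exp (- u)" by (simp add: exp_minus field_simps)
    also have "\<dots> \<le> 43 * real q * exp (- u)" using q by simp
    finally show False using \<delta> E by simp
  qed
  have \<tau>0: "\<tau> > 0" by (simp add: \<tau>_def)
  have \<tau>\<epsilon>: "\<tau> < \<epsilon> / 2"
  proof -
    have "\<tau> * (real n / 5) \<le> \<tau> * exp (real n / 5)"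
    proof (rule mult_left_mono)
      show "real n / 5 \<le> exp (real n / 5)" using exp_ge_add_one_self[of "real n / 5"] by linarith
    qed (use \<tau>0 in simp)
    also have "\<dots> = 1" by (simp add: \<tau>_def exp_add[symmetric])
    finally have 1: "\<tau> * real n \<le> 5" by simp
    have "30 < real n * \<epsilon>\<^sup>2" using u3 by (simp add: u_def)
    also have "\<dots> \<le> real n * \<epsilon>" using n0 \<epsilon> by (simp add: power2_eq_square mult_left_le)
    finally have "30 < real n * \<epsilon>" .
    with 1 have "\<tau> * real n < (\<epsilon> / 2) * real n" by (simp add: mult.commute)
    then show ?thesis using n0 by (simp only: mult_less_cancel_right_pos)
  qed
  define x y w where "x = 4 * real n * \<tau> * real q" and "y = real q * (1 / (2 * 2 ^ n * \<tau>\<^sup>2))"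
    and "w = real q * (2 * exp (- 2 * real n * (\<epsilon> / 2)\<^sup>2))"
  have x: "x \<le> real q * (40 * exp (- u))"
  proof -
    have "real n / 10 \<le> exp (real n / 10)" using exp_ge_add_one_self[of "real n / 10"] by linarith
    then have "real n / 10 * \<tau> \<le> exp (real n / 10) * \<tau>" using \<tau>0 by (intro mult_right_mono) auto
    also have "\<dots> = exp (- (real n / 10))" by (simp add: \<tau>_def exp_add[symmetric])
    also have "\<dots> \<le> exp (- u)" using u_le by simp
    finally have "4 * real n * \<tau> \<le> 40 * exp (- u)" by (simp add: mult_ac)
    then have "4 * real n * \<tau> * real q \<le> 40 * exp (- u) * real q" by (rule mult_right_mono) simp
    then show ?thesis by (simp add: x_def mult_ac)
  qed
  have y: "y \<le> real q * exp (- u)"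
  proof -
    have "exp (1 / 2 :: real) ^ 2 \<le> 2 ^ 2"
      using exp_le by (simp add: exp_of_nat_mult[symmetric])
    then have "exp (1 / 2 :: real) \<le> 2" by (rule power2_le_imp_le) simp
    then have "exp (1 / 2 :: real) ^ n \<le> 2 ^ n" by (intro power_mono) auto
    then have two: "exp (real n / 2) \<le> 2 ^ n" by (simp add: exp_of_nat_mult[symmetric])
    have \<tau>2: "\<tau>\<^sup>2 = exp (- (2 * real n / 5))" by (simp add: \<tau>_def power2_eq_square exp_add[symmetric])
    have "exp u \<le> exp (real n / 10)" using u_le by simp
    also have "\<dots> = exp (real n / 2) * \<tau>\<^sup>2" unfolding \<tau>2 exp_add[symmetric] by simp
    also have "\<dots> \<le> 2 ^ n * \<tau>\<^sup>2" using two by (rule mult_right_mono) simp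
    also have "\<dots> \<le> 2 * 2 ^ n * \<tau>\<^sup>2" by simp
    finally have "1 / (2 * 2 ^ n * \<tau>\<^sup>2) \<le> 1 / exp u" using \<tau>0 by (intro divide_left_mono) auto
    then show ?thesis unfolding y_def by (intro mult_left_mono) (simp_all add: exp_minus inverse_eq_divide)
  qed
  have w: "w \<le> real q * (2 * exp (- u))"
    unfolding w_def by (intro mult_left_mono) (simp_all add: u_def power_divide)
  have "x + y + w \<le> 43 * real q * exp (- u)" using x y w by (simp add: algebra_simps)
  with \<delta> E have sum: "x + y + w \<le> \<delta>" by simp
  have nonneg: "x \<ge> 0" "y \<ge> 0" "w \<ge> 0" using \<tau>0 by (simp_all add: x_def y_def w_def)
  have X: "1 - x \<le> exp (- 4 * real n * \<tau>) ^ q"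
    using exp_ge_add_one_self[of "- x"] by (simp add: exp_of_nat_mult[symmetric] x_def mult_ac)
  have "1 - \<delta> \<le> exp (- 4 * real n * \<tau>) ^ q * ((1 - y) * (1 - w))"
    using mult_one_minus_ge[OF nonneg _ X] sum \<delta> by linarith
  then have "ennreal (1 - \<delta>) \<le> ennreal (exp (- 4 * real n * \<tau>) ^ q * ((1 - y) * (1 - w)))"
    by (rule ennreal_leI)
  also have "\<dots> = ennreal (exp (- 4 * real n * \<tau>)) ^ q * (ennreal (1 - y) * ennreal (1 - w))"
    using nonneg sum \<delta> by (simp add: ennreal_mult ennreal_power)
  also have "\<dots> \<le> success_prob \<epsilon>"
    using success_prob_ge[OF \<tau>0 \<tau>\<epsilon> \<epsilon>(2)] by (simp only: y_def w_def)
  finally show ?thesis .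
qed

text \<open>
  For \<open>q = 1\<close> and \<open>\<delta>\<close> close to 1 the number of samples may be far below \<open>1 / \<epsilon>\<^sup>2\<close>; then the required
  success probability is small and comes from the Gaussian density near its center.
\<close>

lemma success_prob_ge_single_query:
  assumes \<epsilon>: "0 < \<epsilon>" "\<epsilon> * sqrt (real n) \<le> 9" and q: "q = 1"
  shows "ennreal (3 / 4 * (\<epsilon> * sqrt (real n) * exp (- 242))) \<le> success_prob \<epsilon>"
proof -
  interpret noise: prob_space "noise n" by (rule prob_space_noise[OF n_pos])
  interpret product_prob_space "\<lambda>_. noise n" "{..<q}" by standard
  \<comment> \<open>Here \<open>\<tau>\<close> is of the order of the standard deviation of the
    noise; atypical pairs then have probability at most 1/4, since
    \<open>2 * n \<le> 2 ^ n\<close>.\<close>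
  define \<tau> where "\<tau> = 1 / sqrt (real n)"
  let ?b = "\<epsilon> * sqrt (real n) * exp (- 242)"
  let ?T = "{\<omega>. LC_typical n \<tau> (t []) \<omega>}"
  have \<tau>0: "\<tau> > 0" using n_pos by (simp add: \<tau>_def)
  have b0: "?b \<ge> 0" using \<epsilon> by simp
  have "2 * n \<le> 2 ^ n" using n_pos by (induction n rule: nat_induct_non_zero) auto
  then have "2 * real n \<le> 2 ^ n" by (metis of_nat_le_iff of_nat_mult of_nat_numeral of_nat_power)
  then have "1 / (2 * 2 ^ n * \<tau>\<^sup>2) \<le> 1 / 4"
    using n_pos by (simp add: \<tau>_def power_divide field_simps)
  \<comment> \<open>The only query is asked on the empty history, so any path may be inserted, in
    particular \<open>undefined\<close>.\<close>
  moreover have "1 - 1 / (2 * 2 ^ n * \<tau>\<^sup>2) \<le> measure_pmf.prob J ?T"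
    using prob_always_typical[OF \<tau>0, of undefined] q by simp
  ultimately have T: "3 / 4 \<le> measure_pmf.prob J ?T" by linarith
  have lower: "ennreal ?b * indicator ?T \<omega>
      \<le> emeasure N {z \<in> space N. all_accurate (LC_prior n) \<epsilon> q (fst \<omega>) (snd \<omega>) z t}" for \<omega>
  proof (cases "\<omega> \<in> ?T")
    case True
    define d where "d = measure_pmf.expectation (fst \<omega>) (t []) - posterior_mean (LC_prior n) (snd \<omega>) (t [])"
    have "\<bar>d\<bar> \<le> \<tau> + \<tau>"
      using True unfolding LC_typical_def d_def mem_Collect_eq by linarith
    then have "\<bar>d\<bar> \<le> 2 / sqrt (real n)" by (simp add: \<tau>_def)
    moreover have "\<epsilon> \<le> 9 / sqrt (real n)" using \<epsilon> n_pos by (simp add: field_simps)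
    ultimately have "\<bar>d\<bar> + \<epsilon> \<le> 11 / sqrt (real n)" by (simp add: add_divide_distrib[symmetric])
    \<comment> \<open>With \<open>K = 2 + 9 = 11\<close> the exponent is
      \<open>2 * K\<^sup>2 = 242\<close>.\<close>
    from noise_interval_lower_bound[OF n_pos \<epsilon>(1) this]
    have "ennreal ?b \<le> emeasure (noise n) {x. \<bar>d - x\<bar> < \<epsilon>}"
      by (simp add: noise.emeasure_eq_measure ennreal_leI)
    also have "\<dots> = emeasure N {z \<in> space N. z 0 \<in> {x. \<bar>d - x\<bar> < \<epsilon>}}"
      using q by (intro emeasure_PiM_Collect_single[symmetric]) auto
    also have "{z \<in> space N. z 0 \<in> {x. \<bar>d - x\<bar> < \<epsilon>}}
        = {z \<in> space N. all_accurate (LC_prior n) \<epsilon> q (fst \<omega>) (snd \<omega>) z t}"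
      using q by (auto simp: all_accurate_iff_path[OF refl] d_def algebra_simps)
    finally show ?thesis using True by simp
  qed simp
  have "ennreal (3 / 4 * ?b) = ennreal ?b * ennreal (3 / 4)"
    using b0 by (simp add: ennreal_mult[symmetric] mult.commute)
  also have "\<dots> \<le> ennreal ?b * ennreal (measure_pmf.prob J ?T)"
    using T by (intro mult_left_mono ennreal_leI) auto
  also have "\<dots> = (\<Sum>\<omega>\<in>set_pmf J. (ennreal ?b * indicator ?T \<omega>) * ennreal (pmf J \<omega>))"
    by (simp only: sum_pmf_indicator[OF finite_LC_hypothesis_and_samples, symmetric] sum_distrib_left mult.assoc)
  also have "\<dots> \<le> success_prob \<epsilon>"
    unfolding success_prob_def by (intro sum_mono mult_right_mono lower) auto
  finally show ?thesis .
qed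

end

section \<open>Averaging over the seed of the analyst\<close>

lemma analyst_LC_game:
  assumes "n > 0" "analyst (LC_universe n) q R s"
  shows "LC_game n q (s r)"
proof
  from assms(2) have sets: "sets R = sets borel" and meas:
    "\<And>i x. i < q \<Longrightarrow> x \<in> LC_universe n \<Longrightarrow>
       (\<lambda>(r, a). s r (map a [0..<i]) x) \<in> borel_measurable (R \<Otimes>\<^sub>M histories i)"
    by (auto simp: analyst_def)
  show "(\<lambda>a. s r (map a [0..<i]) x) \<in> borel_measurable (histories i)"
    if "i < q" "x \<in> LC_universe n" for i x
    using measurable_Pair2[OF meas[OF that], of r] sets_eq_imp_space_eq[OF sets] by simp
qed (use assms in \<open>auto simp: analyst_def\<close>)

lemma measurable_all_accurate:
  assumes n: "n > 0" and an: "analyst (LC_universe n) q R s"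
    and \<omega>: "(p, xs) \<in> set_pmf (hypothesis_and_samples (LC_prior n) n)"
  shows "(\<lambda>(z, r). all_accurate (LC_prior n) \<epsilon> q p xs z (s r))
           \<in> measurable (PiM {..<q} (\<lambda>_. noise n) \<Otimes>\<^sub>M R) (count_space UNIV)"
proof -
  let ?W = "PiM {..<q} (\<lambda>_. noise n) \<Otimes>\<^sub>M R"
  let ?m = "\<lambda>w i a. posterior_mean (LC_prior n) xs (s (snd w) (map a [0..<i]))"
  let ?e = "\<lambda>w i a. measure_pmf.expectation p (s (snd w) (map a [0..<i]))"
  let ?path = "\<lambda>w i. path (?m w) (fst w) i"
  have meas: "(\<lambda>wa. s (snd (fst wa)) (map (snd wa) [0..<i]) x) \<in> borel_measurable (?W \<Otimes>\<^sub>M histories i)"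
    if "i < q" "x \<in> LC_universe n" for i x
  proof -
    have "(\<lambda>(r, a). s r (map a [0..<i]) x) \<in> borel_measurable (R \<Otimes>\<^sub>M histories i)"
      using an that by (auto simp: analyst_def)
    from measurable_compose[OF _ this, of "\<lambda>wa. (snd (fst wa), snd wa)" "?W \<Otimes>\<^sub>M histories i"]
    show ?thesis by (simp add: case_prod_unfold)
  qed
  have m: "(\<lambda>wa. ?m (fst wa) i (snd wa)) \<in> borel_measurable (?W \<Otimes>\<^sub>M histories i)" if "i < q" for i
    by (rule measurable_posterior_mean_LC[OF meas[OF that] \<omega>])
  have e: "(\<lambda>wa. ?e (fst wa) i (snd wa)) \<in> borel_measurable (?W \<Otimes>\<^sub>M histories i)" if "i < q" for i
    by (rule measurable_expectation_LC[OF meas[OF that] hypothesis_and_samplesD(1)[OF \<omega>]])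
  have z: "(\<lambda>w. fst w i) \<in> borel_measurable ?W" if "i < q" for i
  proof -
    have "(\<lambda>z. z i) \<in> borel_measurable (PiM {..<q} (\<lambda>_. noise n))"
      using that measurable_component_singleton[of i "{..<q}" "\<lambda>_. noise n"]
      by (simp cong: measurable_cong_sets)
    from measurable_compose[OF measurable_fst this] show ?thesis .
  qed
  have [measurable]: "(\<lambda>w. ?e w i (?path w i)) \<in> borel_measurable ?W"
    "(\<lambda>w. ?m w i (?path w i)) \<in> borel_measurable ?W" "(\<lambda>w. fst w i) \<in> borel_measurable ?W"
    if "i \<in> {..<q}" for i
  proof -
    from that have i: "i < q" by simp
    have "(\<lambda>w. ?path w i) \<in> measurable ?W (histories i)"
      by (rule measurable_path) (use i in \<open>auto intro: z m simp: case_prod_unfold\<close>)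
    then have "(\<lambda>w. (w, ?path w i)) \<in> measurable ?W (?W \<Otimes>\<^sub>M histories i)" by simp
    note c = measurable_compose[OF this]
    show "(\<lambda>w. ?e w i (?path w i)) \<in> borel_measurable ?W" using c[OF e[OF i]] by simp
    show "(\<lambda>w. ?m w i (?path w i)) \<in> borel_measurable ?W" using c[OF m[OF i]] by simp
    show "(\<lambda>w. fst w i) \<in> borel_measurable ?W" by (rule z[OF i])
  qed
  have "(\<lambda>(z, r). all_accurate (LC_prior n) \<epsilon> q p xs z (s r))
      = (\<lambda>w. \<forall>i\<in>{..<q}. \<bar>?e w i (?path w i) - (?m w i (?path w i) + fst w i)\<bar> < \<epsilon>)"
    by (simp add: all_accurate_iff_path[OF refl] Ball_def case_prod_unfold)
  also have "\<dots> \<in> measurable ?W (count_space UNIV)" by measurable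
  finally show ?thesis .
qed

text \<open>The bound \<open>c\<close> holds for every frozen seed, hence also after integration
  over \<open>R\<close>; Tonelli identifies the average with the probability in the product
  space.\<close>

lemma prob_all_accurate_ge:
  assumes n: "n > 0" and an: "analyst (LC_universe n) q R s"
    and c: "\<And>r. ennreal c \<le> LC_game.success_prob n q (s r) \<epsilon>"
  shows "c \<le> prob_all_accurate (LC_prior n) n \<epsilon> q R s"
proof -
  let ?P = "LC_prior n"
  let ?J = "hypothesis_and_samples ?P n"
  let ?Jr = "restrict_space (measure_pmf ?J) (set_pmf ?J)"
  let ?N = "PiM {..<q} (\<lambda>_. noise n)"
  let ?A = "\<lambda>\<omega> z r. all_accurate ?P \<epsilon> q (fst \<omega>) (snd \<omega>) z (s r)"
  let ?Q = "\<lambda>(\<omega>, y). case y of (z, r) \<Rightarrow> ?A \<omega> z r"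
  from an interpret R: prob_space R by (simp add: analyst_def)
  interpret N: prob_space ?N by (intro prob_space_PiM prob_space_noise n)
  interpret NR: pair_prob_space ?N R ..
  interpret G: prob_space "game_space ?P n q R" by (rule prob_space_game_space[OF n R.prob_space_axioms])
  have slice: "(\<lambda>y. ?Q (\<omega>, y)) \<in> measurable (?N \<Otimes>\<^sub>M R) (count_space UNIV)" if "\<omega> \<in> set_pmf ?J" for \<omega>
    using measurable_all_accurate[OF n an, of "fst \<omega>" "snd \<omega>" \<epsilon>] that by simp
  \<comment> \<open>The restricted first factor is discrete and countable, so measurability of every
    slice suffices.\<close>
  have "?Q \<in> measurable (?Jr \<Otimes>\<^sub>M (?N \<Otimes>\<^sub>M R)) (count_space UNIV)"
    by (rule measurable_pair_restrict_pmf1[OF countable_set_pmf slice])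
  then have Ev: "{w \<in> space (?Jr \<Otimes>\<^sub>M (?N \<Otimes>\<^sub>M R)). ?Q w} \<in> sets (?Jr \<Otimes>\<^sub>M (?N \<Otimes>\<^sub>M R))" (is "?Ev \<in> _")
    by simp
  have inner: "emeasure (?N \<Otimes>\<^sub>M R) (Pair \<omega> -` ?Ev) = (\<integral>\<^sup>+r. emeasure ?N {z \<in> space ?N. ?A \<omega> z r} \<partial>R)"
    and inner_meas: "(\<lambda>r. emeasure ?N {z \<in> space ?N. ?A \<omega> z r}) \<in> borel_measurable R"
    if \<omega>: "\<omega> \<in> set_pmf ?J" for \<omega>
  proof -
    let ?B = "{y \<in> space (?N \<Otimes>\<^sub>M R). ?Q (\<omega>, y)}"
    have B: "?B \<in> sets (?N \<Otimes>\<^sub>M R)" using slice[OF \<omega>] by simp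
    have eq: "Pair \<omega> -` ?Ev = ?B" using \<omega> by (auto simp: space_pair_measure space_restrict_space)
    have sl: "(\<lambda>z. (z, r)) -` ?B = {z \<in> space ?N. ?A \<omega> z r}" if "r \<in> space R" for r
      using that by (auto simp: space_pair_measure)
    show "emeasure (?N \<Otimes>\<^sub>M R) (Pair \<omega> -` ?Ev) = (\<integral>\<^sup>+r. emeasure ?N {z \<in> space ?N. ?A \<omega> z r} \<partial>R)"
      unfolding eq NR.emeasure_pair_measure_alt2[OF B] by (intro nn_integral_cong) (simp only: sl)
    show "(\<lambda>r. emeasure ?N {z \<in> space ?N. ?A \<omega> z r}) \<in> borel_measurable R"
      using NR.measurable_emeasure_Pair2[OF B] by (subst measurable_cong[OF arg_cong[OF sl[symmetric]]])
  qed
  have "ennreal c \<le> (\<integral>\<^sup>+r. ennreal c \<partial>R)" by (simp add: R.emeasure_space_1)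
  also have "\<dots> \<le> (\<integral>\<^sup>+r. (\<Sum>\<omega>\<in>set_pmf ?J. emeasure ?N {z \<in> space ?N. ?A \<omega> z r} * ennreal (pmf ?J \<omega>)) \<partial>R)"
    using c by (intro nn_integral_mono) (simp add: LC_game.success_prob_def[OF analyst_LC_game[OF n an]])
  also have "\<dots> = (\<Sum>\<omega>\<in>set_pmf ?J. (\<integral>\<^sup>+r. emeasure ?N {z \<in> space ?N. ?A \<omega> z r} \<partial>R) * ennreal (pmf ?J \<omega>))"
    using inner_meas by (subst nn_integral_sum) (auto simp: nn_integral_multc)
  \<comment> \<open>The indicator allows the sum to be read as an integral over \<open>?J\<close>
    and then over its restriction to the support.\<close>
  also have "\<dots> = (\<Sum>\<omega>\<in>set_pmf ?J. (emeasure (?N \<Otimes>\<^sub>M R) (Pair \<omega> -` ?Ev) * indicator (set_pmf ?J) \<omega>) * ennreal (pmf ?J \<omega>))"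
    by (intro sum.cong refl) (simp only: inner indicator_simps(1) mult_1_right)
  also have "\<dots> = (\<integral>\<^sup>+\<omega>. emeasure (?N \<Otimes>\<^sub>M R) (Pair \<omega> -` ?Ev) * indicator (set_pmf ?J) \<omega> \<partial>?J)"
    by (rule nn_integral_measure_pmf_finite[symmetric]) (use finite_LC_hypothesis_and_samples in auto)
  also have "\<dots> = (\<integral>\<^sup>+\<omega>. emeasure (?N \<Otimes>\<^sub>M R) (Pair \<omega> -` ?Ev) \<partial>?Jr)"
    by (rule nn_integral_restrict_space[symmetric]) simp
  also have "\<dots> = emeasure (game_space ?P n q R) ?Ev"
    unfolding game_space_def by (rule NR.emeasure_pair_measure_alt[OF Ev, symmetric])
  also have "\<dots> = ennreal (prob_all_accurate ?P n \<epsilon> q R s)"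
    unfolding prob_all_accurate_def G.emeasure_eq_measure
    by (intro arg_cong[where f = ennreal] arg_cong[where f = "measure _"]) (auto simp: game_space_def)
  finally show ?thesis
    by (simp add: prob_all_accurate_def)
qed

text \<open>One of the 100 multiples of the logarithm produces \<open>\<delta> / q\<close>; the
  other 99 amount to at least 49.5 and absorb the factor 43.\<close>

lemma exp_neg_le_if_sample_size:
  fixes \<delta> :: real
  assumes \<delta>: "0 < \<delta>" and q: "q \<ge> 1" and L: "ln (real q / \<delta>) \<ge> 1 / 2" and v: "v \<ge> 100 * ln (real q / \<delta>)"
  shows "43 * real q * exp (- v) \<le> \<delta>"
proof -
  let ?L = "ln (real q / \<delta>)"
  have "exp (- v) \<le> exp (- 99 * ?L + - ?L)" using v by simp
  also have "\<dots> = exp (- 99 * ?L) * (\<delta> / real q)"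
    unfolding exp_add using \<delta> q by (simp add: exp_minus)
  finally have "43 * real q * exp (- v) \<le> 43 * real q * (exp (- 99 * ?L) * (\<delta> / real q))"
    by (intro mult_left_mono) auto
  also have "\<dots> = (43 * exp (- 99 * ?L)) * \<delta>" using q by simp
  also have "\<dots> \<le> 1 * \<delta>"
  proof (rule mult_right_mono)
    have "43 \<le> exp (99 * ?L)" using exp_ge_add_one_self[of "99 * ?L"] L by linarith
    then show "43 * exp (- 99 * ?L) \<le> 1" by (simp add: exp_minus field_simps)
  qed (use \<delta> in simp)
  finally show ?thesis by simp
qed

theorem mainTheorem3:
  shows "\<exists>C::real. C > 0 \<and>
    (\<forall>(\<epsilon>::real) (\<delta>::real) (q::nat) (n::nat).
       0 < \<epsilon> \<and> \<epsilon> < 1 \<and> 0 < \<delta> \<and> \<delta> < 1 \<and> q \<ge> 1 \<and>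
       real n \<ge> C / \<epsilon>\<^sup>2 * ln (real q / \<delta>) \<longrightarrow>
       (\<forall>(R::real measure) (s::((nat \<Rightarrow> bit) \<times> bit) strategy).
          analyst (LC_universe n) q R s \<longrightarrow>
          prob_all_accurate (LC_prior n) n \<epsilon> q R s \<ge> 1 - \<delta>))"
\<comment> \<open>The factor 1000 serves the exponential estimates; \<open>exp 242\<close>
  compensates the small density bound in the single-query case.\<close>
proof (intro exI[of _ "1000 * exp 242"] conjI allI impI; (elim conjE)?)
  fix \<epsilon> \<delta> :: real and q n :: nat and R :: "real measure" and s :: "((nat \<Rightarrow> bit) \<times> bit) strategy"
  let ?C = "1000 * exp 242 :: real" and ?L = "ln (real q / \<delta>)"
  assume \<epsilon>: "0 < \<epsilon>" "\<epsilon> < 1" and \<delta>: "0 < \<delta>" "\<delta> < 1" and q: "1 \<le> q"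
    and n: "?C / \<epsilon>\<^sup>2 * ?L \<le> real n" and an: "analyst (LC_universe n) q R s"
  have "1 < real q / \<delta>" using \<delta> q by (simp add: field_simps)
  then have L: "?L > 0" by simp
  then have "0 < ?C / \<epsilon>\<^sup>2 * ?L" using \<epsilon> by simp
  with n have n0: "n > 0" by (cases n) auto
  have CL: "?C * ?L \<le> real n * \<epsilon>\<^sup>2" using n \<epsilon> by (simp add: field_simps)
  have "1000 * ?L \<le> ?C * ?L" using L by simp
  with CL have v: "100 * ?L \<le> real n * \<epsilon>\<^sup>2 / 10" by simp
  show "1 - \<delta> \<le> prob_all_accurate (LC_prior n) n \<epsilon> q R s"
  proof (rule prob_all_accurate_ge[OF n0 an])
    fix r
    interpret LC_game n q "s r" by (rule analyst_LC_game[OF n0 an])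
    show "ennreal (1 - \<delta>) \<le> success_prob \<epsilon>"
    proof (cases "43 * real q * exp (- real n * \<epsilon>\<^sup>2 / 10) \<le> \<delta>")
      case True
      then show ?thesis using \<epsilon> q \<delta> by (intro success_prob_ge_if_enough_samples) auto
    next
      case False
      \<comment> \<open>If the exponential bound fails, the logarithm is below 1/2. Then
        \<open>q < 2 * \<delta> < 2\<close>, which forces \<open>q = 1\<close> and
        \<open>\<delta> > 1 / 2\<close>.\<close>
      then have "?L < 1 / 2" using exp_neg_le_if_sample_size[OF \<delta>(1) q _ v] by fastforce
      then have "exp ?L < exp (1 / 2)" by simp
      then have "real q / \<delta> < exp (1 / 2)" using \<delta> q by (simp add: exp_ln)
      also have "exp (1 / 2 :: real) \<le> 2"
      proof (rule power2_le_imp_le)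
        show "exp (1 / 2 :: real) ^ 2 \<le> 2 ^ 2" using exp_le by (simp add: exp_of_nat_mult[symmetric])
      qed simp
      finally have q\<delta>: "real q < 2 * \<delta>" using \<delta> by (simp add: field_simps)
      with \<delta> q have q1: "q = 1" by linarith
      let ?u = "real n * \<epsilon>\<^sup>2 / 10" and ?x = "\<epsilon> * sqrt (real n)"
      from False q\<delta> q1 have "1 / 2 < 43 * exp (- ?u)" by simp
      then have "exp ?u < 86" by (simp add: exp_minus field_simps)
      also have "86 \<le> (2 :: real) ^ 7" by simp
      also have "\<dots> \<le> exp 1 ^ 7" using exp_ge_add_one_self[of 1] by (intro power_mono) auto
      also have "\<dots> = exp (7 :: real)" by (simp add: exp_of_nat_mult[symmetric])
      finally have "?u < 7" by simp
      moreover have x2: "?x\<^sup>2 = real n * \<epsilon>\<^sup>2" by (simp add: power_mult_distrib mult.commute)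
      ultimately have "?x\<^sup>2 \<le> 9\<^sup>2" by simp
      then have x9: "?x \<le> 9" by (rule power2_le_imp_le) simp
      have x0: "?x \<ge> 0" using \<epsilon> by simp
      \<comment> \<open>The required probability \<open>1 - \<delta>\<close> is at most the
        logarithm, hence at most \<open>?x\<^sup>2 / ?C\<close>. Since \<open>?x \<le> 9\<close>,
        this is linear in \<open>?x\<close>, like the available lower bound.\<close>
      have "ln \<delta> \<le> \<delta> - 1" by (rule ln_le_minus_one[OF \<delta>(1)])
      then have "1 - \<delta> \<le> ?L" using q1 \<delta> by (simp add: ln_div)
      also have "\<dots> = ?C * ?L * exp (- 242) / 1000" by (simp add: exp_minus)
      also have "\<dots> \<le> ?x\<^sup>2 * exp (- 242) / 1000"
        using CL by (intro divide_right_mono mult_right_mono) (simp_all only: x2, simp_all)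
      also have "\<dots> \<le> (9 * ?x) * exp (- 242) / 1000"
        unfolding power2_eq_square by (intro divide_right_mono mult_right_mono x9 x0) simp_all
      also have "\<dots> \<le> 3 / 4 * (?x * exp (- 242))" using \<epsilon> by simp
      finally have "ennreal (1 - \<delta>) \<le> ennreal (3 / 4 * (?x * exp (- 242)))" by (rule ennreal_leI)
      also have "\<dots> \<le> success_prob \<epsilon>"
        by (rule success_prob_ge_single_query[OF \<epsilon>(1) x9 q1])
      finally show ?thesis .
    qed
  qed
qed simp

end
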